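(* Let $A=\Bbbk\mathcal{Q}/\mathcal{I}$ be a gentle or locally gentle algebra. The center $Z(A)$ of $A$ is generated as a $\Bbbk$-algebra by the following elements of $A$: (1) the identity $\mathbf{1}=\sum_{v\in\mathcal{Q}_0}\epsilon_v$; (2) the finite maximal paths $\gamma\in\mathcal{B}$ such that $\gamma$ is a cycle in $\mathcal{Q}$; (3) the elements $m_\gamma$ for each infinite maximal path $\gamma$ of $A$. Moreover, the elements of the form (1)-(2) together with the positive powers of the elements of the form (3) give a basis of $Z(A)$.
   Context: $\Bbbk$ is a field of characteristic $0$. A quiver $\mathcal{Q}=(\mathcal{Q}_0,\mathcal{Q}_1,s,t)$ has vertex set $\mathcal{Q}_0$, arrow set $\mathcal{Q}_1$, source and target maps $s,t$; all quivers are finite and connected with $|\mathcal{Q}_0|,|\mathcal{Q}_1|\ge 1$. $\operatorname{indeg}(v)$, $\operatorname{outdeg}(v)$ are the numbers of arrows with target, respectively source, $v$. Paths are composed left to right; $\epsilon_v$ is the stationary path at $v$; $\Bbbk\mathcal{Q}$ is the path algebra. $A=\Bbbk\mathcal{Q}/\mathcal{I}$ is gentle if: (i) $\operatorname{indeg}(v),\operatorname{outdeg}(v)\le 2$ for all $v$; (ii) whenever $s(\alpha)=t(\beta)=t(\beta')$ with $\beta\ne\beta'$ arrows, exactly one of $\beta\alpha,\beta'\alpha$ is in $\mathcal{I}$; (iii) whenever $t(\alpha)=s(\beta)=s(\beta')$ with $\beta\neq\beta'$, exactly one of $\alpha\beta,\alpha\beta'$ is in $\mathcal{I}$; (iv)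 $\mathcal{I}$ is generated by paths of length $2$; (v) $A$ is finite dimensional. It is locally gentle if it satisfies (i)-(iv) and is infinite dimensional. $\mathcal{B}$ is the basis of $A$ consisting of the paths not in $\mathcal{I}$. A path $p\in\mathcal{B}$ is a finite maximal path if $p\alpha\in\mathcal{I}$ and $\alpha p\in\mathcal{I}$ for every arrow $\alpha$. A cycle is a path of positive length whose source and target coincide; a cycle $c$ is primitive if it is not $(c')^k$ for a cycle $c'$ and $k>1$. For a primitive cycle $c$ with $c^2\notin\mathcal{I}$, $c^\infty$ is called an infinite maximal path (rotations of $c$ give the same one). Each arrow $\alpha$ lies in a unique (finite or infinite) maximal path $\gamma_\alpha$. $\gamma_r(\alpha)$ is the unique longest path in $\mathcal{B}$ with first arrow $\alpha$ and no repeated arrows; if $\gamma_\alpha$ is infinite, then $\gamma_r(\alpha)$ is a primitive cycle with $\gamma_\alpha=\gamma_r(\alpha)^\infty$. For an infinite maximal path $\gamma$, $m_\gamma=\sum_{\alpha\in\mathcal{Q}_1,\ \gamma_\alpha=\gamma}\gamma_r(\alpha)$. *)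

theory Defs
  imports
    "Jordan_Normal_Form.VS_Connect"
    "HOL-Algebra.QuotRing"
    "HOL-Algebra.Subrings"
    "HOL-Library.Poly_Mapping"
    "Graph_Theory.Digraph_Component"
begin

hide_const (open) Multiset.mult Polynomial.smult Modules.module

section \<open>Quivers and paths\<close>

text \<open>
  A quiver is a directed multigraph in the sense of \<open>Graph_Theory\<close>: sources are \<^const>\<open>tail\<close>,
  targets are \<^const>\<open>head\<close>; loops and parallel arrows are allowed.  A path is a pair of its source
  vertex and its list of arrows, read from left to right, so \<open>(v, [])\<close> is the stationary path
  at \<open>v\<close>.
\<close>

type_synonym ('v, 'e) quiver_path = "'v \<times> 'e list"

definition quiver :: "('v, 'e) pre_digraph \<Rightarrow> bool" where
  "quiver Q \<longleftrightarrow> fin_digraph Q \<and> Digraph_Component.connected Q \<and> verts Q \<noteq> {} \<and> arcs Q \<noteq> {}"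

definition quiver_paths :: "('v, 'e) pre_digraph \<Rightarrow> ('v, 'e) quiver_path set" where
  "quiver_paths Q = {(u, p). \<exists>v. pre_digraph.awalk Q u p v}"

definition path_source :: "('v, 'e) quiver_path \<Rightarrow> 'v" where
  "path_source p = fst p"

definition path_target :: "('v, 'e) pre_digraph \<Rightarrow> ('v, 'e) quiver_path \<Rightarrow> 'v" where
  "path_target Q p = last (pre_digraph.awalk_verts Q (fst p) (snd p))"

definition path_comp :: "('v, 'e) quiver_path \<Rightarrow> ('v, 'e) quiver_path \<Rightarrow> ('v, 'e) quiver_path" where
  "path_comp p q = (fst p, snd p @ snd q)"

definition arrow_path :: "('v, 'e) pre_digraph \<Rightarrow> 'e \<Rightarrow> ('v, 'e) quiver_path" where
  "arrow_path Q a = (tail Q a, [a])"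

definition path_power :: "('v, 'e) quiver_path \<Rightarrow> nat \<Rightarrow> ('v, 'e) quiver_path" where
  "path_power c k = (fst c, concat (replicate k (snd c)))"

definition quiver_cycle :: "('v, 'e) pre_digraph \<Rightarrow> ('v, 'e) quiver_path \<Rightarrow> bool" where
  "quiver_cycle Q c \<longleftrightarrow> c \<in> quiver_paths Q \<and> snd c \<noteq> [] \<and> path_source c = path_target Q c"

definition primitive_cycle :: "('v, 'e) pre_digraph \<Rightarrow> ('v, 'e) quiver_path \<Rightarrow> bool" where
  "primitive_cycle Q c \<longleftrightarrow>
     quiver_cycle Q c \<and> \<not> (\<exists>c' k. quiver_cycle Q c' \<and> k > 1 \<and> c = path_power c' k)"

definition rotations :: "('v, 'e) pre_digraph \<Rightarrow> ('v, 'e) quiver_path \<Rightarrow> ('v, 'e) quiver_path set" where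
  "rotations Q c = {(tail Q (hd (rotate n (snd c))), rotate n (snd c)) | n. True}"


section \<open>Path algebras, quotients, centers\<close>

text \<open>
  The field \<open>\<bbbk>\<close> is a type of class \<^class>\<open>field_char_0\<close>; as a structure it is \<^term>\<open>class_ring\<close>.
\<close>

definition path_algebra ::
  "('v, 'e) pre_digraph \<Rightarrow> ('k::field_char_0, ('v, 'e) quiver_path \<Rightarrow>\<^sub>0 'k) module" where
  "path_algebra Q = \<lparr>
     carrier = {f. Poly_Mapping.keys f \<subseteq> quiver_paths Q},
     mult = (\<lambda>f g. \<Sum>p\<in>Poly_Mapping.keys f. \<Sum>q\<in>Poly_Mapping.keys g.
               if path_target Q p = path_source q
               then Poly_Mapping.single (path_comp p q)
                      (Poly_Mapping.lookup f p * Poly_Mapping.lookup g q)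
               else 0),
     one = (\<Sum>v\<in>verts Q. Poly_Mapping.single (v, []) 1),
     zero = 0,
     add = (+),
     smult = (\<lambda>c. Poly_Mapping.map ((*) c))\<rparr>"

abbreviation path_elt :: "('v, 'e) quiver_path \<Rightarrow> (('v, 'e) quiver_path \<Rightarrow>\<^sub>0 'k::field_char_0)" where
  "path_elt p \<equiv> Poly_Mapping.single p 1"

text \<open>The library's quotient ring \<^const>\<open>FactRing\<close>, with the induced scalar multiplication on cosets.\<close>

definition quotient_algebra :: "('k, 'a) module \<Rightarrow> 'a set \<Rightarrow> ('k, 'a set) module" where
  "quotient_algebra M I =
     ring.extend (M Quot I) (module.fields (\<lambda>c X. \<Union>x\<in>X. I +>\<^bsub>M\<^esub> (c \<odot>\<^bsub>M\<^esub> x)))"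

definition algebra_center :: "('k, 'a) module \<Rightarrow> 'a set" where
  "algebra_center A = {z \<in> carrier A. \<forall>x\<in>carrier A. z \<otimes>\<^bsub>A\<^esub> x = x \<otimes>\<^bsub>A\<^esub> z}"

definition generated_subalgebra :: "('k, 'a) module \<Rightarrow> 'a set \<Rightarrow> 'a set" where
  "generated_subalgebra A S =
     \<Inter>{B. subring B A \<and> (\<forall>c. \<forall>b\<in>B. c \<odot>\<^bsub>A\<^esub> b \<in> B) \<and> S \<subseteq> B}"


section \<open>Gentle and locally gentle algebras\<close>

abbreviation bound_quiver_algebra ::
  "('v, 'e) pre_digraph \<Rightarrow> (('v, 'e) quiver_path \<Rightarrow>\<^sub>0 'k::field_char_0) set
    \<Rightarrow> ('k, (('v, 'e) quiver_path \<Rightarrow>\<^sub>0 'k) set) module" where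
  "bound_quiver_algebra Q I \<equiv> quotient_algebra (path_algebra Q) I"

definition gentle_conditions ::
  "('v, 'e) pre_digraph \<Rightarrow> (('v, 'e) quiver_path \<Rightarrow>\<^sub>0 'k::field_char_0) set \<Rightarrow> bool" where
  "gentle_conditions Q I \<longleftrightarrow>
     (\<forall>v\<in>verts Q. in_degree Q v \<le> 2 \<and> out_degree Q v \<le> 2) \<and>
     (\<forall>a\<in>arcs Q. \<forall>b\<in>arcs Q. \<forall>b'\<in>arcs Q.
        tail Q a = head Q b \<and> tail Q a = head Q b' \<and> b \<noteq> b' \<longrightarrow>
        (path_elt (tail Q b, [b, a]) \<in> I) \<noteq> (path_elt (tail Q b', [b', a]) \<in> I)) \<and>
     (\<forall>a\<in>arcs Q. \<forall>b\<in>arcs Q. \<forall>b'\<in>arcs Q.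
        head Q a = tail Q b \<and> head Q a = tail Q b' \<and> b \<noteq> b' \<longrightarrow>
        (path_elt (tail Q a, [a, b]) \<in> I) \<noteq> (path_elt (tail Q a, [a, b']) \<in> I)) \<and>
     (\<exists>R \<subseteq> {p \<in> quiver_paths Q. length (snd p) = 2}. I = Idl\<^bsub>path_algebra Q\<^esub> (path_elt ` R))"

definition gentle ::
  "('v, 'e) pre_digraph \<Rightarrow> (('v, 'e) quiver_path \<Rightarrow>\<^sub>0 'k::field_char_0) set \<Rightarrow> bool" where
  "gentle Q I \<longleftrightarrow> quiver Q \<and> gentle_conditions Q I \<and>
     vectorspace.fin_dim class_ring (bound_quiver_algebra Q I)"

definition locally_gentle ::
  "('v, 'e) pre_digraph \<Rightarrow> (('v, 'e) quiver_path \<Rightarrow>\<^sub>0 'k::field_char_0) set \<Rightarrow> bool" where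
  "locally_gentle Q I \<longleftrightarrow> quiver Q \<and> gentle_conditions Q I \<and>
     \<not> vectorspace.fin_dim class_ring (bound_quiver_algebra Q I)"


section \<open>Maximal paths\<close>

definition basis_paths ::
  "('v, 'e) pre_digraph \<Rightarrow> (('v, 'e) quiver_path \<Rightarrow>\<^sub>0 'k::field_char_0) set \<Rightarrow> ('v, 'e) quiver_path set" where
  "basis_paths Q I = {p \<in> quiver_paths Q. path_elt p \<notin> I}"

definition path_class ::
  "('v, 'e) pre_digraph \<Rightarrow> (('v, 'e) quiver_path \<Rightarrow>\<^sub>0 'k::field_char_0) set
    \<Rightarrow> ('v, 'e) quiver_path \<Rightarrow> (('v, 'e) quiver_path \<Rightarrow>\<^sub>0 'k) set" where
  "path_class Q I p = I +>\<^bsub>path_algebra Q\<^esub> path_elt p"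

text \<open>Products of non-composable paths are \<open>0\<close>, hence lie in \<open>I\<close>.\<close>

definition finite_maximal_paths ::
  "('v, 'e) pre_digraph \<Rightarrow> (('v, 'e) quiver_path \<Rightarrow>\<^sub>0 'k::field_char_0) set \<Rightarrow> ('v, 'e) quiver_path set" where
  "finite_maximal_paths Q I = {p \<in> basis_paths Q I. \<forall>a\<in>arcs Q.
     path_elt p \<otimes>\<^bsub>path_algebra Q\<^esub> path_elt (arrow_path Q a) \<in> I \<and>
     path_elt (arrow_path Q a) \<otimes>\<^bsub>path_algebra Q\<^esub> path_elt p \<in> I}"

text \<open>
  The infinite maximal path \<open>c\<^sup>\<infinity>\<close> is encoded as the set of all rotations of the primitive
  cycle \<open>c\<close>, because rotations of \<open>c\<close> give the same infinite maximal path.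
\<close>

definition infinite_maximal_paths ::
  "('v, 'e) pre_digraph \<Rightarrow> (('v, 'e) quiver_path \<Rightarrow>\<^sub>0 'k::field_char_0) set
    \<Rightarrow> ('v, 'e) quiver_path set set" where
  "infinite_maximal_paths Q I =
     {rotations Q c | c. primitive_cycle Q c \<and> path_elt (path_power c 2) \<notin> I}"

datatype ('v, 'e) maximal_path =
  Finite_Path "('v, 'e) quiver_path"
| Infinite_Path "('v, 'e) quiver_path set"

definition maximal_paths ::
  "('v, 'e) pre_digraph \<Rightarrow> (('v, 'e) quiver_path \<Rightarrow>\<^sub>0 'k::field_char_0) set \<Rightarrow> ('v, 'e) maximal_path set" where
  "maximal_paths Q I =
     Finite_Path ` finite_maximal_paths Q I \<union> Infinite_Path ` infinite_maximal_paths Q I"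

fun lies_in :: "'e \<Rightarrow> ('v, 'e) maximal_path \<Rightarrow> bool" where
  "lies_in a (Finite_Path p) \<longleftrightarrow> a \<in> set (snd p)"
| "lies_in a (Infinite_Path C) \<longleftrightarrow> (\<exists>c\<in>C. a \<in> set (snd c))"

definition maximal_path_of ::
  "('v, 'e) pre_digraph \<Rightarrow> (('v, 'e) quiver_path \<Rightarrow>\<^sub>0 'k::field_char_0) set \<Rightarrow> 'e \<Rightarrow> ('v, 'e) maximal_path" where
  "maximal_path_of Q I a = (THE \<gamma>. \<gamma> \<in> maximal_paths Q I \<and> lies_in a \<gamma>)"

definition gamma_r ::
  "('v, 'e) pre_digraph \<Rightarrow> (('v, 'e) quiver_path \<Rightarrow>\<^sub>0 'k::field_char_0) set \<Rightarrow> 'e \<Rightarrow> ('v, 'e) quiver_path" where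
  "gamma_r Q I a = (THE p. is_arg_max (\<lambda>p. length (snd p))
     (\<lambda>p. p \<in> basis_paths Q I \<and> snd p \<noteq> [] \<and> hd (snd p) = a \<and> distinct (snd p)) p)"

definition m_element ::
  "('v, 'e) pre_digraph \<Rightarrow> (('v, 'e) quiver_path \<Rightarrow>\<^sub>0 'k::field_char_0) set
    \<Rightarrow> ('v, 'e) quiver_path set \<Rightarrow> (('v, 'e) quiver_path \<Rightarrow>\<^sub>0 'k) set" where
  "m_element Q I \<gamma> = (\<Oplus>\<^bsub>bound_quiver_algebra Q I\<^esub>
     a\<in>{a \<in> arcs Q. maximal_path_of Q I a = Infinite_Path \<gamma>}. path_class Q I (gamma_r Q I a))"

definition finite_maximal_cycles ::
  "('v, 'e) pre_digraph \<Rightarrow> (('v, 'e) quiver_path \<Rightarrow>\<^sub>0 'k::field_char_0) set \<Rightarrow> ('v, 'e) quiver_path set" where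
  "finite_maximal_cycles Q I = {p \<in> finite_maximal_paths Q I. quiver_cycle Q p}"


section \<open>The family of central elements\<close>

text \<open>
  Indexing the elements makes it possible to say that a family, and not merely its underlying set,
  is a basis.
\<close>

datatype ('v, 'e) center_index =
  Identity
| Maximal_Cycle "('v, 'e) quiver_path"
| M_Power "('v, 'e) quiver_path set" nat

definition center_indices ::
  "('v, 'e) pre_digraph \<Rightarrow> (('v, 'e) quiver_path \<Rightarrow>\<^sub>0 'k::field_char_0) set \<Rightarrow> ('v, 'e) center_index set" where
  "center_indices Q I = {Identity} \<union> Maximal_Cycle ` finite_maximal_cycles Q I \<union>
     {M_Power \<gamma> n | \<gamma> n. \<gamma> \<in> infinite_maximal_paths Q I \<and> n > 0}"

fun center_family ::
  "('v, 'e) pre_digraph \<Rightarrow> (('v, 'e) quiver_path \<Rightarrow>\<^sub>0 'k::field_char_0) set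
    \<Rightarrow> ('v, 'e) center_index \<Rightarrow> (('v, 'e) quiver_path \<Rightarrow>\<^sub>0 'k) set" where
  "center_family Q I Identity = \<one>\<^bsub>bound_quiver_algebra Q I\<^esub>"
| "center_family Q I (Maximal_Cycle p) = path_class Q I p"
| "center_family Q I (M_Power \<gamma> n) = m_element Q I \<gamma> [^]\<^bsub>bound_quiver_algebra Q I\<^esub> n"

end

theory Submission
  imports Defs
begin

text \<open>
  Modulo the ideal, an element is determined by its coefficients at the paths that avoid the
  relations, and the gentle conditions say that ``\<open>ab\<close> is not a relation'' is a partial injection on
  arrows.  Comparing coefficients of \<open>az\<close> and \<open>za\<close> for an arrow \<open>a\<close> shows what a central \<open>z\<close> looks
  like: the coefficients of all vertices agree, and a path of positive length in the support of \<open>z\<close> is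
  a closed path that either cannot be prolonged or continues into itself.  In the second case it is a
  power of a cycle without repeated arrows, and \<open>z\<close> has the same coefficient at all its rotations.
  So the members of the family are sums over disjoint finite sets of paths, and the center consists of
  the elements that are constant on each of these sets and vanish elsewhere.
\<close>

section \<open>Finitely supported functions\<close>

text \<open>The relations are paths, so the ideal is spanned by the paths it contains; this is why
  the coefficients at \<open>B\<close> are well defined on cosets and serve as coordinates for every
  equation in the quotient. The combinatorics rests on determinism: a surviving path is fixed by its
  length together with its first arrow, and dually its last. Hence an arrow repeated in a path that
  continues into itself yields a nontrivial rotation fixing the list of arrows, and such a list is a
  proper power. The same determinism makes the product of two different rotations of a
  repetition-free cycle vanish, since the last arrow of the first factor has only one successor. So
  the powers of \<open>m_element\<close> contain no mixed terms. Disjointness of the supports is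
  used twice: a single coefficient isolates one member of the family, which gives independence, and
  the finite support of a central element meets only finitely many of the sets, which makes its
  expansion finite.\<close>

lemma poly_mapping_eq_sum_singles:
  fixes f :: "'a \<Rightarrow>\<^sub>0 'b::comm_monoid_add"
  shows "f = (\<Sum>p\<in>Poly_Mapping.keys f. Poly_Mapping.single p (Poly_Mapping.lookup f p))"
proof (rule poly_mapping_eqI)
  fix k
  show "Poly_Mapping.lookup f k =
    Poly_Mapping.lookup (\<Sum>p\<in>Poly_Mapping.keys f. Poly_Mapping.single p (Poly_Mapping.lookup f p)) k"
    by (cases "k \<in> Poly_Mapping.keys f")
      (auto simp: lookup_sum lookup_single when_def in_keys_iff)
qed

text \<open>Reduces additive statements about the path algebra to scalar multiples of single paths.
  The set \<open>X\<close> is passed to the \<open>single\<close> case so that membership in the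
  quiver is still known there.\<close>

lemma poly_mapping_additive_induct [consumes 1, case_names zero single add]:
  fixes f :: "'a \<Rightarrow>\<^sub>0 'b::comm_monoid_add"
  assumes "Poly_Mapping.keys f \<subseteq> X"
    and zero: "P 0"
    and single: "\<And>p c. p \<in> X \<Longrightarrow> P (Poly_Mapping.single p c)"
    and add: "\<And>f g. P f \<Longrightarrow> P g \<Longrightarrow> P (f + g)"
  shows "P f"
proof -
  have "P (\<Sum>p\<in>S. Poly_Mapping.single p (Poly_Mapping.lookup f p))" if "finite S" "S \<subseteq> X" for S
    using that by (induction S) (auto intro: zero single add)
  then show ?thesis
    by (subst poly_mapping_eq_sum_singles) (simp add: assms(1))
qed

lemma keys_scale:
  fixes c :: "'k::field_char_0"
  shows "Poly_Mapping.keys (Poly_Mapping.map ((*) c) f) \<subseteq> Poly_Mapping.keys f"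
  by (auto simp: in_keys_iff Poly_Mapping.map.rep_eq when_def)

lemma lookup_scale [simp]:
  fixes c :: "'k::field_char_0"
  shows "Poly_Mapping.lookup (Poly_Mapping.map ((*) c) f) p = c * Poly_Mapping.lookup f p"
  by (auto simp: Poly_Mapping.map.rep_eq when_def)

lemma keys_sum_subset:
  "(\<And>i. i \<in> A \<Longrightarrow> Poly_Mapping.keys (f i) \<subseteq> X) \<Longrightarrow> Poly_Mapping.keys (\<Sum>i\<in>A. f i) \<subseteq> X"
proof (induction A rule: infinite_finite_induct)
  case (insert x F)
  then show ?case using keys_add[of "f x" "\<Sum>i\<in>F. f i"] by auto
qed auto

section \<open>Paths\<close>

lemma path_target_Nil [simp]: "path_target Q (v, []) = v"
  by (simp add: path_target_def pre_digraph.awalk_verts.simps)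

lemma path_target_nonempty: "l \<noteq> [] \<Longrightarrow> path_target Q (v, l) = head Q (last l)"
proof (induction l arbitrary: v)
  case (Cons a l)
  then show ?case
    by (cases l) (auto simp: path_target_def pre_digraph.awalk_verts.simps)
qed simp

lemma path_target_comp:
  "path_target Q p = path_source q \<Longrightarrow> path_target Q (path_comp p q) = path_target Q q"
  by (cases p; cases q; cases "snd q = []")
    (auto simp: path_comp_def path_source_def path_target_nonempty)

lemma path_source_comp [simp]: "path_source (path_comp p q) = path_source p"
  by (simp add: path_comp_def path_source_def)

lemma path_comp_assoc: "path_comp (path_comp p q) r = path_comp p (path_comp q r)"
  by (simp add: path_comp_def)

lemma quiver_paths_iff:
  assumes "wf_digraph Q"
  shows "(v, l) \<in> quiver_paths Q \<longleftrightarrow> v \<in> verts Q \<and> set l \<subseteq> arcs Q \<and> (l \<noteq> [] \<longrightarrow> v = tail Q (hd l)) \<and>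
    successively (\<lambda>a b. head Q a = tail Q b) l"
proof -
  have "(\<exists>w. pre_digraph.cas Q v l w) \<longleftrightarrow> (l \<noteq> [] \<longrightarrow> v = tail Q (hd l)) \<and>
      successively (\<lambda>a b. head Q a = tail Q b) l"
  proof (induction l arbitrary: v)
    case (Cons a l)
    then show ?case
      by (cases l) (auto simp: pre_digraph.cas.simps)
  qed (use pre_digraph.cas.simps(1) in \<open>fastforce\<close>)
  then show ?thesis
    by (auto simp: quiver_paths_def pre_digraph.awalk_def)
qed

section \<open>The path algebra\<close>

lemma path_algebra_simps:
  "carrier (path_algebra Q) = {f. Poly_Mapping.keys f \<subseteq> quiver_paths Q}"
  "\<one>\<^bsub>path_algebra Q\<^esub> = (\<Sum>v\<in>verts Q. Poly_Mapping.single (v, []) 1)"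
  "\<zero>\<^bsub>path_algebra Q\<^esub> = 0"
  "x \<oplus>\<^bsub>path_algebra Q\<^esub> y = x + y"
  "c \<odot>\<^bsub>path_algebra Q\<^esub> x = Poly_Mapping.map ((*) c) x"
  by (simp_all add: path_algebra_def)

text \<open>The product is defined by sums over supports, and supports shrink under cancellation.
  Summing over any larger finite sets lets distributivity be compared term by term.\<close>

lemma path_algebra_mult_eq_sum:
  assumes "finite S" "finite T" "Poly_Mapping.keys f \<subseteq> S" "Poly_Mapping.keys g \<subseteq> T"
  shows "f \<otimes>\<^bsub>path_algebra Q\<^esub> g = (\<Sum>p\<in>S. \<Sum>q\<in>T. if path_target Q p = path_source q
           then Poly_Mapping.single (path_comp p q) (Poly_Mapping.lookup f p * Poly_Mapping.lookup g q)
           else 0)"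
proof -
  have "f \<otimes>\<^bsub>path_algebra Q\<^esub> g = (\<Sum>p\<in>Poly_Mapping.keys f. \<Sum>q\<in>T. if path_target Q p = path_source q
           then Poly_Mapping.single (path_comp p q) (Poly_Mapping.lookup f p * Poly_Mapping.lookup g q)
           else 0)"
    unfolding path_algebra_def monoid.simps using assms
    by (intro sum.cong refl sum.mono_neutral_left) (auto simp: not_in_keys_iff_lookup_eq_zero)
  also have "\<dots> = (\<Sum>p\<in>S. \<Sum>q\<in>T. if path_target Q p = path_source q
           then Poly_Mapping.single (path_comp p q) (Poly_Mapping.lookup f p * Poly_Mapping.lookup g q)
           else 0)"
    using assms
    by (intro sum.mono_neutral_left) (auto simp: not_in_keys_iff_lookup_eq_zero intro!: sum.neutral)
  finally show ?thesis .
qed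

lemma path_algebra_mult_single [simp]:
  "Poly_Mapping.single p a \<otimes>\<^bsub>path_algebra Q\<^esub> Poly_Mapping.single q b =
    (if path_target Q p = path_source q then Poly_Mapping.single (path_comp p q) (a * b) else 0)"
  by (subst path_algebra_mult_eq_sum[of "{p}" "{q}"]) auto

lemma path_algebra_mult_add_left:
  "(f + g) \<otimes>\<^bsub>path_algebra Q\<^esub> h = f \<otimes>\<^bsub>path_algebra Q\<^esub> h + g \<otimes>\<^bsub>path_algebra Q\<^esub> h"
proof -
  let ?S = "Poly_Mapping.keys f \<union> Poly_Mapping.keys g"
  have "Poly_Mapping.keys (f + g) \<subseteq> ?S" by (rule keys_add)
  then show ?thesis
    by (subst (1 2 3) path_algebra_mult_eq_sum[of ?S "Poly_Mapping.keys h"])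
      (auto simp: sum.distrib[symmetric] lookup_add distrib_right single_add intro!: sum.cong)
qed

lemma path_algebra_mult_add_right:
  "h \<otimes>\<^bsub>path_algebra Q\<^esub> (f + g) = h \<otimes>\<^bsub>path_algebra Q\<^esub> f + h \<otimes>\<^bsub>path_algebra Q\<^esub> g"
proof -
  let ?S = "Poly_Mapping.keys f \<union> Poly_Mapping.keys g"
  have "Poly_Mapping.keys (f + g) \<subseteq> ?S" by (rule keys_add)
  then show ?thesis
    by (subst (1 2 3) path_algebra_mult_eq_sum[of "Poly_Mapping.keys h" ?S])
      (auto simp: sum.distrib[symmetric] lookup_add distrib_left single_add intro!: sum.cong)
qed

lemma path_algebra_mult_zero [simp]:
  "0 \<otimes>\<^bsub>path_algebra Q\<^esub> f = 0" "f \<otimes>\<^bsub>path_algebra Q\<^esub> 0 = 0"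
  by (simp_all add: path_algebra_def)

lemma path_algebra_mult_sum_left:
  "(\<Sum>i\<in>A. f i) \<otimes>\<^bsub>path_algebra Q\<^esub> g = (\<Sum>i\<in>A. f i \<otimes>\<^bsub>path_algebra Q\<^esub> g)"
  by (induction A rule: infinite_finite_induct) (auto simp: path_algebra_mult_add_left)

lemma path_algebra_mult_sum_right:
  "g \<otimes>\<^bsub>path_algebra Q\<^esub> (\<Sum>i\<in>A. f i) = (\<Sum>i\<in>A. g \<otimes>\<^bsub>path_algebra Q\<^esub> f i)"
  by (induction A rule: infinite_finite_induct) (auto simp: path_algebra_mult_add_right)

lemma path_algebra_mult_assoc:
  "(f \<otimes>\<^bsub>path_algebra Q\<^esub> g) \<otimes>\<^bsub>path_algebra Q\<^esub> h = f \<otimes>\<^bsub>path_algebra Q\<^esub> (g \<otimes>\<^bsub>path_algebra Q\<^esub> h)"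
proof -
  have "Poly_Mapping.keys f \<subseteq> UNIV" "Poly_Mapping.keys g \<subseteq> UNIV" "Poly_Mapping.keys h \<subseteq> UNIV"
    by auto
  then show ?thesis
  proof (induction f rule: poly_mapping_additive_induct)
    case (single p a)
    from single(2) show ?case
    proof (induction g rule: poly_mapping_additive_induct)
      case (single q b)
      from \<open>Poly_Mapping.keys h \<subseteq> UNIV\<close> show ?case
      proof (induction h rule: poly_mapping_additive_induct)
        case (single r c)
        then show ?case by (auto simp: path_comp_assoc path_target_comp mult.assoc)
      qed (auto simp: path_algebra_mult_add_right)
    qed (auto simp: path_algebra_mult_add_right path_algebra_mult_add_left)
  qed (auto simp: path_algebra_mult_add_left)
qed

lemma path_comp_in_quiver_paths:
  assumes "wf_digraph Q" "p \<in> quiver_paths Q" "q \<in> quiver_paths Q" "path_target Q p = path_source q"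
  shows "path_comp p q \<in> quiver_paths Q"
  using assms
  by (cases p; cases q; cases "snd p = []"; cases "snd q = []")
    (auto simp: quiver_paths_iff path_comp_def path_source_def successively_append_iff path_target_nonempty)

lemma keys_path_algebra_mult:
  "Poly_Mapping.keys (f \<otimes>\<^bsub>path_algebra Q\<^esub> g) \<subseteq>
    {path_comp p q | p q. p \<in> Poly_Mapping.keys f \<and> q \<in> Poly_Mapping.keys g \<and> path_target Q p = path_source q}"
  unfolding path_algebra_def monoid.simps
  by (intro keys_sum_subset) (auto simp del: split_paired_Ex)

lemma Nil_in_quiver_paths [simp]: "wf_digraph Q \<Longrightarrow> (v, []) \<in> quiver_paths Q \<longleftrightarrow> v \<in> verts Q"
  by (simp add: quiver_paths_iff)

lemma path_source_in_verts: "p \<in> quiver_paths Q \<Longrightarrow> path_source p \<in> verts Q"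
  by (auto simp: quiver_paths_def pre_digraph.awalk_def path_source_def)

lemma path_target_in_verts: "wf_digraph Q \<Longrightarrow> p \<in> quiver_paths Q \<Longrightarrow> path_target Q p \<in> verts Q"
  by (cases p; cases "snd p = []")
    (auto simp: quiver_paths_iff path_target_nonempty wf_digraph.head_in_verts subset_iff)

lemma path_comp_Nil [simp]:
  "path_comp p (v, []) = p"  "path_source p = v \<Longrightarrow> path_comp (v, []) p = p"
  by (auto simp: path_comp_def path_source_def)

lemma ring_path_algebra:
  assumes "fin_digraph Q"
  shows "ring (path_algebra Q :: ('k::field_char_0, _) module)"
proof -
  interpret fin_digraph Q by fact
  have wf: "wf_digraph Q" ..
  \<comment> \<open>Against a path exactly one summand of the unit survives, the one at its source
    or at its target; the support condition ensures that this vertex belongs to the quiver.\<close>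
  have one_mult: "\<one>\<^bsub>path_algebra Q\<^esub> \<otimes>\<^bsub>path_algebra Q\<^esub> f = f" "f \<otimes>\<^bsub>path_algebra Q\<^esub> \<one>\<^bsub>path_algebra Q\<^esub> = f"
    if "Poly_Mapping.keys f \<subseteq> quiver_paths Q" for f :: "('a, 'b) quiver_path \<Rightarrow>\<^sub>0 'k"
    using that
  proof (induction f rule: poly_mapping_additive_induct)
    case (single p c)
    {
      case 1
      have "\<one>\<^bsub>path_algebra Q\<^esub> \<otimes>\<^bsub>path_algebra Q\<^esub> Poly_Mapping.single p c =
          (\<Sum>v\<in>verts Q. if v = path_source p then Poly_Mapping.single p c else 0)"
        by (auto simp: path_algebra_simps path_algebra_mult_sum_left intro!: sum.cong)
      with single show ?case by (simp add: path_source_in_verts)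
    next
      case 2
      have "Poly_Mapping.single p c \<otimes>\<^bsub>path_algebra Q\<^esub> \<one>\<^bsub>path_algebra Q\<^esub> =
          (\<Sum>v\<in>verts Q. if v = path_target Q p then Poly_Mapping.single p c else 0)"
        by (auto simp: path_algebra_simps path_algebra_mult_sum_right path_source_def intro!: sum.cong)
      with single show ?case by (simp add: path_target_in_verts[OF wf])
    }
  qed (auto simp: path_algebra_mult_add_left path_algebra_mult_add_right)
  have mult_closed: "Poly_Mapping.keys (f \<otimes>\<^bsub>path_algebra Q\<^esub> g) \<subseteq> quiver_paths Q"
    if "Poly_Mapping.keys f \<subseteq> quiver_paths Q" "Poly_Mapping.keys g \<subseteq> quiver_paths Q"
    for f g :: "('a, 'b) quiver_path \<Rightarrow>\<^sub>0 'k"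
    by (rule order.trans[OF keys_path_algebra_mult])
      (use that in \<open>auto intro!: path_comp_in_quiver_paths[OF wf]\<close>)
  have add_closed: "Poly_Mapping.keys (f + g) \<subseteq> quiver_paths Q"
    if "Poly_Mapping.keys f \<subseteq> quiver_paths Q" "Poly_Mapping.keys g \<subseteq> quiver_paths Q"
    for f g :: "('a, 'b) quiver_path \<Rightarrow>\<^sub>0 'k"
    using keys_add[of f g] that by blast
  have one_closed: "Poly_Mapping.keys (\<Sum>v\<in>verts Q. Poly_Mapping.single (v, []) (1::'k)) \<subseteq> quiver_paths Q"
    by (rule keys_sum_subset) (auto simp: wf)
  show ?thesis
  proof (rule ringI)
    show "abelian_group (path_algebra Q :: ('k, _) module)"
    proof (rule abelian_groupI)
      fix x :: "('a, 'b) quiver_path \<Rightarrow>\<^sub>0 'k"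
      assume "x \<in> carrier (path_algebra Q)"
      then show "\<exists>y\<in>carrier (path_algebra Q). y \<oplus>\<^bsub>path_algebra Q\<^esub> x = \<zero>\<^bsub>path_algebra Q\<^esub>"
        by (intro bexI[of _ "- x"]) (auto simp: path_algebra_simps in_keys_iff)
    qed (auto simp: path_algebra_simps add.assoc add.commute dest: add_closed[THEN subsetD, rotated 2])
    show "Group.monoid (path_algebra Q :: ('k, _) module)"
      using mult_closed one_mult one_closed
      by (intro monoidI) (auto simp: path_algebra_simps path_algebra_mult_assoc)
  qed (auto simp: path_algebra_simps path_algebra_mult_add_left path_algebra_mult_add_right)
qed

section \<open>Ideals generated by paths of length two\<close>

text \<open>Locates a forbidden consecutive pair, through which the path then factors as a multiple
  of a generator of the ideal.\<close>

lemma not_successively_split: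
  "\<not> successively P l \<Longrightarrow> \<exists>u a b w. l = u @ a # b # w \<and> \<not> P a b"
proof (induction l)
  case (Cons x l)
  show ?case
  proof (cases "successively P l")
    case True
    then obtain y l' where "l = y # l'" "\<not> P x y"
      using Cons.prems by (cases l) auto
    then show ?thesis by blast
  next
    case False
    then obtain u a b w where "l = u @ a # b # w" "\<not> P a b"
      using Cons.IH by blast
    then show ?thesis by (metis append_Cons)
  qed
qed simp

text \<open>Closure of \<open>Z\<close> under prolongation on both sides is exactly absorption for
  single paths; the general case follows because every path in the support of a product is a
  composition of paths from the two supports.\<close>

lemma ideal_path_algebra_span:
  assumes "fin_digraph Q" "Z \<subseteq> quiver_paths Q"
    and left: "\<And>p q. p \<in> Z \<Longrightarrow> q \<in> quiver_paths Q \<Longrightarrow> path_target Q q = path_source p \<Longrightarrow> path_comp q p \<in> Z"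
    and right: "\<And>p q. p \<in> Z \<Longrightarrow> q \<in> quiver_paths Q \<Longrightarrow> path_target Q p = path_source q \<Longrightarrow> path_comp p q \<in> Z"
  shows "ideal {f. Poly_Mapping.keys f \<subseteq> Z} (path_algebra Q :: ('k::field_char_0, _) module)"
proof -
  interpret ring "path_algebra Q :: ('k, _) module" by (rule ring_path_algebra) fact
  show ?thesis
  proof (rule idealI)
    show "subgroup {f. Poly_Mapping.keys f \<subseteq> Z} (add_monoid (path_algebra Q :: ('k, _) module))"
    proof (rule add.subgroupI)
      fix f :: "('a, 'b) quiver_path \<Rightarrow>\<^sub>0 'k"
      assume f: "f \<in> {f. Poly_Mapping.keys f \<subseteq> Z}"
      then have "Poly_Mapping.keys (- f) \<subseteq> Z" by (auto simp: in_keys_iff)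
      moreover from this f have "\<ominus>\<^bsub>path_algebra Q\<^esub> f = - f"
        using assms(2) by (intro minus_equality) (auto simp: path_algebra_simps)
      ultimately show "\<ominus>\<^bsub>path_algebra Q\<^esub> f \<in> {f. Poly_Mapping.keys f \<subseteq> Z}" by simp
    next
      fix f g :: "('a, 'b) quiver_path \<Rightarrow>\<^sub>0 'k"
      assume "f \<in> {f. Poly_Mapping.keys f \<subseteq> Z}" "g \<in> {f. Poly_Mapping.keys f \<subseteq> Z}"
      then show "f \<oplus>\<^bsub>path_algebra Q\<^esub> g \<in> {f. Poly_Mapping.keys f \<subseteq> Z}"
        using keys_add[of f g] by (auto simp: path_algebra_simps)
    next
      show "{f. Poly_Mapping.keys f \<subseteq> Z} \<noteq> ({} :: (('a, 'b) quiver_path \<Rightarrow>\<^sub>0 'k) set)"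
        by (auto intro!: exI[of _ 0])
    qed (use assms(2) in \<open>auto simp: path_algebra_simps\<close>)
  next
    fix f g :: "('a, 'b) quiver_path \<Rightarrow>\<^sub>0 'k"
    assume *: "f \<in> {f. Poly_Mapping.keys f \<subseteq> Z}" "g \<in> carrier (path_algebra Q)"
    show "g \<otimes>\<^bsub>path_algebra Q\<^esub> f \<in> {f. Poly_Mapping.keys f \<subseteq> Z}"
      unfolding mem_Collect_eq
      by (rule order.trans[OF keys_path_algebra_mult]) (use * in \<open>auto simp: path_algebra_simps intro!: left\<close>)
    show "f \<otimes>\<^bsub>path_algebra Q\<^esub> g \<in> {f. Poly_Mapping.keys f \<subseteq> Z}"
      unfolding mem_Collect_eq
      by (rule order.trans[OF keys_path_algebra_mult]) (use * in \<open>auto simp: path_algebra_simps intro!: right\<close>)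
  qed (rule ring_axioms)
qed

text \<open>The span of \<open>Z\<close> is an ideal containing the generators, so minimality gives
  one inclusion. For the other, each path in \<open>Z\<close> has the form
  \<open>u @ a # b # w\<close> with the middle pair in \<open>R\<close>, hence is a multiple of a
  generator.\<close>

lemma genideal_length_two_paths:
  assumes fin: "fin_digraph Q" and R: "R \<subseteq> {p \<in> quiver_paths Q. length (snd p) = 2}"
  defines "Z \<equiv> {p \<in> quiver_paths Q. \<not> successively (\<lambda>a b. (tail Q a, [a, b]) \<notin> R) (snd p)}"
  shows "Idl\<^bsub>path_algebra Q\<^esub> (path_elt ` R) =
    {f :: ('v, 'e) quiver_path \<Rightarrow>\<^sub>0 'k::field_char_0. Poly_Mapping.keys f \<subseteq> Z}" (is "?J = ?K")
proof
  interpret fin_digraph Q by fact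
  have wf: "wf_digraph Q" ..
  interpret P: ring "path_algebra Q :: ('k, _) module" by (rule ring_path_algebra) fact
  have elt: "path_elt ` R \<subseteq> carrier (path_algebra Q :: ('k, _) module)"
    using R by (auto simp: path_algebra_simps)
  have ideal: "ideal ?K (path_algebra Q)"
  proof (rule ideal_path_algebra_span[OF fin])
    show "Z \<subseteq> quiver_paths Q" by (auto simp: Z_def)
    fix p q
    assume p: "p \<in> Z" and q: "q \<in> quiver_paths Q"
    from p have p': "p \<in> quiver_paths Q" by (simp add: Z_def)
    show "path_comp q p \<in> Z" if "path_target Q q = path_source p"
      using path_comp_in_quiver_paths[OF wf q p' that] p
      by (simp add: Z_def path_comp_def successively_append_iff)
    show "path_comp p q \<in> Z" if "path_target Q p = path_source q"
      using path_comp_in_quiver_paths[OF wf p' q that] p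
      by (simp add: Z_def path_comp_def successively_append_iff)
  qed
  have "path_elt ` R \<subseteq> ?K"
  proof -
    have "p \<in> Z" if p: "p \<in> R" for p
    proof -
      from p R obtain v a b where "p = (v, [a, b])" "p \<in> quiver_paths Q"
        by (cases p) (auto simp: length_Suc_conv numeral_2_eq_2)
      moreover from this have "v = tail Q a" by (simp add: quiver_paths_iff[OF wf])
      ultimately show ?thesis using p by (simp add: Z_def)
    qed
    then show ?thesis by auto
  qed
  with ideal show "?J \<subseteq> ?K" by (intro P.genideal_minimal)
  interpret J: ideal ?J "path_algebra Q" by (rule P.genideal_ideal[OF elt])
  show "?K \<subseteq> ?J"
  proof
    fix f :: "('v, 'e) quiver_path \<Rightarrow>\<^sub>0 'k"
    assume "f \<in> ?K"
    then have "Poly_Mapping.keys f \<subseteq> Z" by simp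
    then show "f \<in> ?J"
    proof (induction f rule: poly_mapping_additive_induct)
      case zero
      show ?case using J.zero_closed by (simp add: path_algebra_simps)
    next
      case (single p c)
      obtain v l where p: "p = (v, l)" by force
      with single obtain u a b w where l: "l = u @ a # b # w" and ab: "(tail Q a, [a, b]) \<in> R"
        using not_successively_split[of "\<lambda>a b. (tail Q a, [a, b]) \<notin> R" l] by (auto simp: Z_def)
      have "(v, l) \<in> quiver_paths Q" using single p by (simp add: Z_def)
      then have arcs: "v \<in> verts Q" "set u \<subseteq> arcs Q" "set w \<subseteq> arcs Q" "b \<in> arcs Q"
        and v: "v = tail Q (hd (u @ [a]))"
        and u: "successively (\<lambda>a b. head Q a = tail Q b) u" "u = [] \<or> head Q (last u) = tail Q a"
        and w: "successively (\<lambda>a b. head Q a = tail Q b) w" "w = [] \<or> head Q b = tail Q (hd w)"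
        by (auto simp: l quiver_paths_iff[OF wf] successively_append_iff successively_Cons hd_append)
      have "path_target Q (v, u) = tail Q a"
      proof (cases "u = []")
        case True
        then show ?thesis by (simp add: v)
      next
        case False
        then show ?thesis using u(2) by (simp add: path_target_nonempty)
      qed
      \<comment> \<open>The scalar is absorbed by the left factor, which leaves an actual generator
        in the middle.\<close>
      then have eq: "Poly_Mapping.single p c = Poly_Mapping.single (v, u) c \<otimes>\<^bsub>path_algebra Q\<^esub>
          (path_elt (tail Q a, [a, b]) \<otimes>\<^bsub>path_algebra Q\<^esub> path_elt (head Q b, w))"
        by (simp add: path_source_def path_target_nonempty path_comp_def p l)
      have paths: "(v, u) \<in> quiver_paths Q" "(head Q b, w) \<in> quiver_paths Q"
        unfolding quiver_paths_iff[OF wf] using arcs u w v by (auto simp: hd_append)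
      have mem: "path_elt (tail Q a, [a, b]) \<in> ?J"
        using P.genideal_self[OF elt] ab by auto
      show ?case
        unfolding eq by (rule J.I_l_closed[OF J.I_r_closed[OF mem]]) (simp_all add: path_algebra_simps paths)
    next
      case (add f g)
      then show ?case using J.a_closed by (simp add: path_algebra_simps)
    qed
  qed
qed

text \<open>Adding the scalar multiplication to the factor ring changes the record type but none of
  the ring operations, so the axioms carry over one by one.\<close>

lemma ring_extend:
  fixes S :: "'a ring"
  assumes "ring S"
  shows "ring (ring.extend S x)"
proof -
  interpret ring S by fact
  show ?thesis
  proof (rule ringI)
    show "abelian_group (ring.extend S x)"
    proof (rule abelian_groupI)
      fix a
      assume "a \<in> carrier (ring.extend S x)"
      then show "\<exists>b\<in>carrier (ring.extend S x). b \<oplus>\<^bsub>ring.extend S x\<^esub> a = \<zero>\<^bsub>ring.extend S x\<^esub>"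
        by (intro bexI[of _ "\<ominus>\<^bsub>S\<^esub> a"]) (simp_all add: ring.defs l_neg)
    qed (simp_all add: ring.defs a_ac)
    show "Group.monoid (ring.extend S x)"
      by (rule monoidI) (simp_all add: ring.defs m_assoc)
  qed (simp_all add: ring.defs l_distr r_distr)
qed

section \<open>The bound quiver algebra\<close>

locale gentle_quiver =
  fixes Q :: "('v, 'e) pre_digraph"
    and I :: "(('v, 'e) quiver_path \<Rightarrow>\<^sub>0 'k::field_char_0) set"
  assumes quiver: "quiver Q" and conditions: "gentle_conditions Q I"
begin

sublocale fin_digraph Q
  using quiver by (simp add: quiver_def)

abbreviation P :: "('k, ('v, 'e) quiver_path \<Rightarrow>\<^sub>0 'k) module" where "P \<equiv> path_algebra Q"
abbreviation A :: "('k, (('v, 'e) quiver_path \<Rightarrow>\<^sub>0 'k) set) module" where "A \<equiv> bound_quiver_algebra Q I"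
abbreviation B where "B \<equiv> basis_paths Q I"
abbreviation cls :: "(('v, 'e) quiver_path \<Rightarrow>\<^sub>0 'k) \<Rightarrow> (('v, 'e) quiver_path \<Rightarrow>\<^sub>0 'k) set"
  where "cls f \<equiv> I +>\<^bsub>P\<^esub> f"

text \<open>Composability and membership in the quiver are built in, so that uniqueness of
  successors and predecessors holds without side conditions and \<open>follows\<close> is a partial
  injection on the whole type.\<close>

definition follows :: "'e \<Rightarrow> 'e \<Rightarrow> bool" where
  "follows a b \<longleftrightarrow> a \<in> arcs Q \<and> b \<in> arcs Q \<and> head Q a = tail Q b \<and> path_elt (tail Q a, [a, b]) \<notin> I"

lemma wf: "wf_digraph Q" ..

sublocale P: ring P
  by (rule ring_path_algebra) (rule fin_digraph)

lemma I_eq: "I = {f. Poly_Mapping.keys f \<subseteq> quiver_paths Q - B}"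
  and basis_iff_successively: "p \<in> B \<longleftrightarrow>
    p \<in> quiver_paths Q \<and> successively (\<lambda>a b. path_elt (tail Q a, [a, b]) \<notin> I) (snd p)"
proof -
  obtain R where R: "R \<subseteq> {p \<in> quiver_paths Q. length (snd p) = 2}"
    and I: "I = Idl\<^bsub>P\<^esub> (path_elt ` R)"
    using conditions[unfolded gentle_conditions_def, THEN conjunct2, THEN conjunct2, THEN conjunct2]
    by blast
  define Z where "Z = {p \<in> quiver_paths Q. \<not> successively (\<lambda>a b. (tail Q a, [a, b]) \<notin> R) (snd p)}"
  have I': "I = {f. Poly_Mapping.keys f \<subseteq> Z}"
    unfolding I Z_def by (rule genideal_length_two_paths[OF fin_digraph R])
  have elt: "path_elt p \<in> I \<longleftrightarrow> p \<in> Z" for p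
    by (subst I') simp
  have B: "B = quiver_paths Q - Z"
    unfolding basis_paths_def elt by (simp add: set_diff_eq)
  have "quiver_paths Q - B = Z" unfolding B by (auto simp: Z_def)
  then show "I = {f. Poly_Mapping.keys f \<subseteq> quiver_paths Q - B}"
    using I' by simp
  \<comment> \<open>A path of length two has only one consecutive pair, so it lies in
    \<open>Z\<close> exactly when it lies in \<open>R\<close>. This removes the chosen generating
    set in favour of \<open>I\<close> itself.\<close>
  have "(tail Q a, [a, b]) \<in> R \<longleftrightarrow> path_elt (tail Q a, [a, b]) \<in> I" for a b
    unfolding elt Z_def using R by auto
  then show "p \<in> B \<longleftrightarrow>
      p \<in> quiver_paths Q \<and> successively (\<lambda>a b. path_elt (tail Q a, [a, b]) \<notin> I) (snd p)"
    unfolding B by (auto simp: Z_def)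
qed

lemma Nil_basis_iff [simp]: "(v, []) \<in> B \<longleftrightarrow> v \<in> verts Q"
  by (simp add: basis_iff_successively wf)

text \<open>\<open>follows\<close> merges the two consecutive conditions, matching endpoints and
  avoidance of relations. Stationary paths are excluded because they have no first arrow to
  determine the source.\<close>

lemma basis_iff:
  assumes "l \<noteq> []"
  shows "(v, l) \<in> B \<longleftrightarrow> v = tail Q (hd l) \<and> set l \<subseteq> arcs Q \<and> successively follows l"
proof (cases "set l \<subseteq> arcs Q")
  case True
  then have "hd l \<in> arcs Q" using assms by auto
  moreover have "successively follows l \<longleftrightarrow>
    successively (\<lambda>a b. path_elt (tail Q a, [a, b]) \<notin> I) l \<and> successively (\<lambda>a b. head Q a = tail Q b) l"
    using True by (induction l rule: induct_list012) (auto simp: follows_def)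
  ultimately show ?thesis
    using True assms by (auto simp: basis_iff_successively quiver_paths_iff[OF wf])
qed (auto simp: basis_iff_successively quiver_paths_iff[OF wf])

lemma basis_subset_paths: "B \<subseteq> quiver_paths Q"
  by (auto simp: basis_paths_def)

lemma path_elt_in_I_iff: "p \<in> quiver_paths Q \<Longrightarrow> path_elt p \<in> I \<longleftrightarrow> p \<notin> B"
  by (auto simp: basis_paths_def)

lemma follows_left_unique:
  assumes "follows b a" "follows b' a"
  shows "b = b'"
  using conditions[unfolded gentle_conditions_def, THEN conjunct2, THEN conjunct1, rule_format, of a b b']
    assms by (auto simp: follows_def)

lemma follows_right_unique:
  assumes "follows a b" "follows a b'"
  shows "b = b'"
  using conditions[unfolded gentle_conditions_def, THEN conjunct2, THEN conjunct2, THEN conjunct1,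
      rule_format, of a b b'] assms
  by (auto simp: follows_def)

lemma follows_arcs: "follows a b \<Longrightarrow> a \<in> arcs Q" "follows a b \<Longrightarrow> b \<in> arcs Q"
  by (auto simp: follows_def)

lemma ideal_I: "ideal I P"
proof -
  obtain R where R: "R \<subseteq> {p \<in> quiver_paths Q. length (snd p) = 2}"
    and I: "I = Idl\<^bsub>P\<^esub> (path_elt ` R)"
    using conditions[unfolded gentle_conditions_def, THEN conjunct2, THEN conjunct2, THEN conjunct2]
    by blast
  show ?thesis
    unfolding I using R by (intro P.genideal_ideal) (auto simp: path_algebra_simps)
qed

sublocale I: ideal I P by (rule ideal_I)

sublocale A: ring A
  unfolding quotient_algebra_def by (rule ring_extend[OF I.quotient_is_ring])

text \<open>The membership form is the usable one: the right-hand side of \<open>I_eq\<close>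
  contains \<open>I\<close> again through \<open>B\<close>, so as a rewrite rule it would
  loop.\<close>

lemma mem_I_iff: "f \<in> I \<longleftrightarrow> Poly_Mapping.keys f \<subseteq> quiver_paths Q - B"
  using set_eq_iff[THEN iffD1, OF I_eq, rule_format, of f] by simp

lemma a_inv_P: "Poly_Mapping.keys f \<subseteq> quiver_paths Q \<Longrightarrow> \<ominus>\<^bsub>P\<^esub> f = - f"
  by (intro P.minus_equality) (auto simp: path_algebra_simps in_keys_iff)

section \<open>Coordinates and linear structure of the quotient\<close>

lemma cls_eq_iff:
  assumes "Poly_Mapping.keys f \<subseteq> quiver_paths Q" "Poly_Mapping.keys g \<subseteq> quiver_paths Q"
  shows "cls f = cls g \<longleftrightarrow> (\<forall>p\<in>B. Poly_Mapping.lookup f p = Poly_Mapping.lookup g p)"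
proof -
  have "cls f = cls g \<longleftrightarrow> f - g \<in> I"
    using P.quotient_eq_iff_same_a_r_cos[OF ideal_I, of f g] assms
    by (simp add: path_algebra_simps a_minus_def a_inv_P)
  also have "\<dots> \<longleftrightarrow> (\<forall>p\<in>B. p \<notin> Poly_Mapping.keys (f - g))"
  proof -
    have "Poly_Mapping.keys (f - g) \<subseteq> quiver_paths Q"
      using keys_diff[of f g] assms by blast
    then show ?thesis unfolding mem_I_iff by auto
  qed
  also have "\<dots> \<longleftrightarrow> (\<forall>p\<in>B. Poly_Mapping.lookup f p = Poly_Mapping.lookup g p)"
    by (simp add: in_keys_iff lookup_minus)
  finally show ?thesis .
qed

lemma A_simps:
  "\<one>\<^bsub>A\<^esub> = cls \<one>\<^bsub>P\<^esub>" "\<zero>\<^bsub>A\<^esub> = I"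
  "carrier A = cls ` {f. Poly_Mapping.keys f \<subseteq> quiver_paths Q}"
  by (simp_all add: quotient_algebra_def ring.defs FactRing_def A_RCOSETS_def RCOSETS_def a_r_coset_def
      path_algebra_simps UNION_singleton_eq_range)

lemma zero_A: "\<zero>\<^bsub>A\<^esub> = cls 0"
  using P.a_coset_join2[OF _ I.a_subgroup I.zero_closed]
  by (simp add: A_simps path_algebra_simps)

lemma cls_closed: "Poly_Mapping.keys f \<subseteq> quiver_paths Q \<Longrightarrow> cls f \<in> carrier A"
  by (simp add: A_simps)

lemma cls_mult:
  assumes "Poly_Mapping.keys f \<subseteq> quiver_paths Q" "Poly_Mapping.keys g \<subseteq> quiver_paths Q"
  shows "cls f \<otimes>\<^bsub>A\<^esub> cls g = cls (f \<otimes>\<^bsub>P\<^esub> g)"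
  using I.rcoset_mult_add[of f g] assms
  by (simp add: quotient_algebra_def ring.defs FactRing_def path_algebra_simps)

lemma cls_add:
  assumes "Poly_Mapping.keys f \<subseteq> quiver_paths Q" "Poly_Mapping.keys g \<subseteq> quiver_paths Q"
  shows "cls f \<oplus>\<^bsub>A\<^esub> cls g = cls (f + g)"
  using I.a_rcos_sum[of f g] assms
  by (simp add: quotient_algebra_def ring.defs FactRing_def path_algebra_simps)

text \<open>Scalar multiplication of a coset is a union over all its representatives. They differ by
  elements vanishing on \<open>B\<close>, so all of them contribute the same coset, and the union
  collapses because \<open>f\<close> itself is a representative.\<close>

lemma cls_smult:
  assumes "Poly_Mapping.keys f \<subseteq> quiver_paths Q"
  shows "c \<odot>\<^bsub>A\<^esub> cls f = cls (Poly_Mapping.map ((*) c) f)"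
proof -
  have smult: "c \<odot>\<^bsub>A\<^esub> X = (\<Union>x\<in>X. cls (Poly_Mapping.map ((*) c) x))" for X
    by (simp add: quotient_algebra_def ring.defs module.defs path_algebra_simps)
  have "cls (Poly_Mapping.map ((*) c) x) = cls (Poly_Mapping.map ((*) c) f)" if "x \<in> cls f" for x
  proof -
    from that obtain h where h: "h \<in> I" "x = h + f"
      by (auto simp only: a_r_coset_def' path_algebra_simps(4) UN_iff singleton_iff)
    have "Poly_Mapping.keys h \<subseteq> quiver_paths Q" using h mem_I_iff by blast
    then have "Poly_Mapping.keys x \<subseteq> quiver_paths Q"
      using h assms keys_add[of h f] by auto
    moreover have "\<forall>p\<in>B. Poly_Mapping.lookup h p = 0"
      using h(1) unfolding mem_I_iff by (auto simp: in_keys_iff)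
    ultimately show ?thesis
      using keys_scale[of c x] keys_scale[of c f] assms
      by (subst cls_eq_iff) (auto simp: h lookup_add)
  qed
  moreover have "f \<in> cls f"
    using assms by (intro I.a_rcos_self) (auto simp: path_algebra_simps)
  ultimately show ?thesis unfolding smult by blast
qed

text \<open>The chosen representative matters only outside \<^term>\<open>B\<close>.\<close>

definition nf :: "(('v, 'e) quiver_path \<Rightarrow>\<^sub>0 'k) set \<Rightarrow> ('v, 'e) quiver_path \<Rightarrow> 'k" where
  "nf X p = Poly_Mapping.lookup (SOME f. Poly_Mapping.keys f \<subseteq> quiver_paths Q \<and> X = cls f) p"

lemma nf_cls [simp]:
  assumes "Poly_Mapping.keys f \<subseteq> quiver_paths Q" "p \<in> B"
  shows "nf (cls f) p = Poly_Mapping.lookup f p"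
proof -
  let ?g = "SOME g. Poly_Mapping.keys g \<subseteq> quiver_paths Q \<and> cls f = cls g"
  have "Poly_Mapping.keys ?g \<subseteq> quiver_paths Q \<and> cls f = cls ?g"
    by (rule someI[of _ f]) (use assms in simp)
  then show ?thesis
    using assms cls_eq_iff[of f ?g] by (simp add: nf_def)
qed

lemma nf_eqI:
  assumes "X \<in> carrier A" "Y \<in> carrier A" "\<And>p. p \<in> B \<Longrightarrow> nf X p = nf Y p"
  shows "X = Y"
proof -
  obtain f g where "Poly_Mapping.keys f \<subseteq> quiver_paths Q" "Poly_Mapping.keys g \<subseteq> quiver_paths Q"
    "X = cls f" "Y = cls g"
    using assms(1,2) by (auto simp: A_simps)
  then show ?thesis using assms(3) by (auto simp: cls_eq_iff)
qed

lemma nf_add: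
  assumes "X \<in> carrier A" "Y \<in> carrier A" "p \<in> B"
  shows "nf (X \<oplus>\<^bsub>A\<^esub> Y) p = nf X p + nf Y p"
proof -
  obtain f g where *: "Poly_Mapping.keys f \<subseteq> quiver_paths Q" "Poly_Mapping.keys g \<subseteq> quiver_paths Q"
    "X = cls f" "Y = cls g"
    using assms(1,2) by (auto simp: A_simps)
  then have "Poly_Mapping.keys (f + g) \<subseteq> quiver_paths Q" using keys_add[of f g] by auto
  with * show ?thesis using assms(3) by (simp add: cls_add lookup_add)
qed

lemma nf_smult:
  assumes "X \<in> carrier A" "p \<in> B"
  shows "nf (c \<odot>\<^bsub>A\<^esub> X) p = c * nf X p"
proof -
  obtain f where *: "Poly_Mapping.keys f \<subseteq> quiver_paths Q" "X = cls f"
    using assms(1) by (auto simp: A_simps)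
  then have "Poly_Mapping.keys (Poly_Mapping.map ((*) c) f) \<subseteq> quiver_paths Q" using keys_scale[of c f] by auto
  with * show ?thesis using assms(2) by (simp add: cls_smult)
qed

lemma nf_zero: "p \<in> B \<Longrightarrow> nf \<zero>\<^bsub>A\<^esub> p = 0"
  by (simp add: zero_A)

lemma nf_finsum:
  assumes "F \<in> T \<rightarrow> carrier A" "p \<in> B"
  shows "nf (finsum A F T) p = (\<Sum>i\<in>T. nf (F i) p)"
  using assms(1)
proof (induction T rule: infinite_finite_induct)
  case (insert x T)
  then show ?case using assms(2) by (simp add: Pi_iff nf_add)
qed (simp_all add: nf_zero assms(2))

lemma smult_closed: "X \<in> carrier A \<Longrightarrow> c \<odot>\<^bsub>A\<^esub> X \<in> carrier A"
  using keys_scale[of c] by (fastforce simp: A_simps cls_smult)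

lemma finite_nf_support: "X \<in> carrier A \<Longrightarrow> finite {p \<in> B. nf X p \<noteq> 0}"
proof -
  assume "X \<in> carrier A"
  then obtain f where f: "Poly_Mapping.keys f \<subseteq> quiver_paths Q" "X = cls f"
    by (auto simp: A_simps)
  then have "{p \<in> B. nf X p \<noteq> 0} \<subseteq> Poly_Mapping.keys f"
    by (auto simp: in_keys_iff)
  then show ?thesis by (rule finite_subset) simp
qed

lemma module_A: "module class_ring A"
proof (rule moduleI)
  show "cring (class_ring :: 'k ring)" by (rule class_cring.cring_axioms)
qed (simp_all add: smult_closed A.abelian_group_axioms,
    (rule nf_eqI, simp_all add: smult_closed nf_add nf_smult algebra_simps)+)

lemma vectorspace_A: "vectorspace class_ring A"
  by (intro vectorspace.intro module_A class_field.field_axioms)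

lemma cls_sum:
  assumes "\<And>i. i \<in> T \<Longrightarrow> Poly_Mapping.keys (F i) \<subseteq> quiver_paths Q"
  shows "(\<Oplus>\<^bsub>A\<^esub>i\<in>T. cls (F i)) = cls (\<Sum>i\<in>T. F i)"
proof (rule nf_eqI)
  have 1: "(\<lambda>i. cls (F i)) \<in> T \<rightarrow> carrier A" using assms by (auto simp: cls_closed)
  then show "(\<Oplus>\<^bsub>A\<^esub>i\<in>T. cls (F i)) \<in> carrier A" by (rule A.finsum_closed)
  have 2: "Poly_Mapping.keys (\<Sum>i\<in>T. F i) \<subseteq> quiver_paths Q" by (rule keys_sum_subset) (rule assms)
  then show "cls (\<Sum>i\<in>T. F i) \<in> carrier A" by (rule cls_closed)
  show "nf (\<Oplus>\<^bsub>A\<^esub>i\<in>T. cls (F i)) p = nf (cls (\<Sum>i\<in>T. F i)) p" if "p \<in> B" for p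
    using that assms 2 by (simp add: nf_finsum[OF 1] lookup_sum)
qed

lemma path_class_eq: "path_class Q I p = cls (path_elt p)"
  by (simp add: path_class_def)

end

section \<open>Successive elements under a partial injection\<close>

lemma successively_functional_eq:
  assumes "\<And>x y z. P x y \<Longrightarrow> P x z \<Longrightarrow> y = z"
    and "length l = length l'" "successively P l" "successively P l'" "hd l = hd l'"
  shows "l = l'"
  using assms(2-)
proof (induction l l' rule: list_induct2)
  case (Cons x xs y ys)
  then show ?case by (cases xs; cases ys) (auto dest: assms(1))
qed simp

text \<open>Here maximality replaces the hypothesis of equal lengths: neither list can stop while
  the other still has a successor.\<close>

lemma successively_functional_eq_maximal:
  assumes "\<And>x y z. P x y \<Longrightarrow> P x z \<Longrightarrow> y = z"
    and "l \<noteq> []" "l' \<noteq> []" "successively P l" "successively P l'" "hd l = hd l'"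
    and "\<And>x. \<not> P (last l) x" "\<And>x. \<not> P (last l') x"
  shows "l = l'"
  using assms(2-)
proof (induction l arbitrary: l')
  case (Cons x xs)
  obtain xs' where l': "l' = x # xs'" using Cons.prems by (cases l') auto
  show ?case
  proof (cases "xs = []")
    case True
    then show ?thesis using Cons.prems l' by (cases xs') auto
  next
    case False
    then have "P x (hd xs)" using Cons.prems by (cases xs) auto
    moreover from this have "xs' \<noteq> []" using Cons.prems l' by auto
    moreover from this have "P x (hd xs')" using Cons.prems l' by (cases xs') auto
    ultimately have "xs = xs'"
      using False Cons.prems l' assms(1)[of x "hd xs" "hd xs'"]
      by (intro Cons.IH) (auto simp: successively_Cons)
    then show ?thesis using l' by simp
  qed
qed simp

text \<open>Both lists are cut at the common element. The right parts agree by determinism forwards;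
  the left parts, read in reverse, agree by determinism backwards.\<close>

lemma successively_split_maximal_eq:
  assumes right: "\<And>x y z. P x y \<Longrightarrow> P x z \<Longrightarrow> y = z" and left: "\<And>x y z. P y x \<Longrightarrow> P z x \<Longrightarrow> y = z"
    and "successively P l" "successively P l'" "a \<in> set l" "a \<in> set l'"
    and "\<And>x. \<not> P (last l) x" "\<And>x. \<not> P (last l') x" "\<And>x. \<not> P x (hd l)" "\<And>x. \<not> P x (hd l')"
  shows "l = l'"
proof -
  obtain us vs where l: "l = us @ a # vs" using assms(5) by (auto simp: in_set_conv_decomp)
  obtain us' vs' where l': "l' = us' @ a # vs'" using assms(6) by (auto simp: in_set_conv_decomp)
  have "a # vs = a # vs'"
    by (rule successively_functional_eq_maximal[of P])
      (use assms l l' in \<open>auto simp: successively_append_iff dest: right\<close>)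
  moreover have "rev (us @ [a]) = rev (us' @ [a])"
  proof (rule successively_functional_eq_maximal[of "\<lambda>x y. P y x"])
    have *: "successively P (us @ [a])" "successively P (us' @ [a])"
      using assms(3,4) by (auto simp: l l' successively_append_iff)
    then show "successively (\<lambda>x y. P y x) (rev (us @ [a]))" "successively (\<lambda>x y. P y x) (rev (us' @ [a]))"
      by (simp_all only: successively_rev)
    show "\<not> P x (last (rev (us @ [a])))" for x
      using assms(9)[of x] by (simp only: last_rev) (simp add: l hd_append split: if_splits)
    show "\<not> P x (last (rev (us' @ [a])))" for x
      using assms(10)[of x] by (simp only: last_rev) (simp add: l' hd_append split: if_splits)
  qed (auto dest: left)
  then have "us = us'" by simp
  ultimately show ?thesis by (simp add: l l')
qed

lemma rotate_rotate_inverse: "\<exists>k. rotate k (rotate n l) = l"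
proof
  \<comment> \<open>For a nonempty list the total shift becomes \<open>n * length l\<close>, a
    multiple of the length. The empty list is treated apart because of the truncated
    subtraction.\<close>
  have "rotate (n * (length l - 1)) (rotate n l) = rotate (n * (length l - 1) + n) l"
    by (simp add: rotate_rotate)
  also have "n * (length l - 1) + n = n * length l" if "l \<noteq> []"
    using that by (cases "length l") (auto simp: algebra_simps)
  then have "rotate (n * (length l - 1) + n) l = l"
    by (cases "l = []") (simp_all add: rotate_id)
  finally show "rotate (n * (length l - 1)) (rotate n l) = l" .
qed

lemma rotate_hd_eq: "a \<in> set l \<Longrightarrow> \<exists>n. hd (rotate n l) = a"
  by (metis hd_rotate_conv_nth in_set_conv_nth length_pos_if_in_set length_greater_0_conv mod_less)

section \<open>Cyclic sequences of arrows\<close>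

context gentle_quiver
begin

text \<open>Closing up under \<open>follows\<close> is stronger than having equal endpoints: it says
  that the square of the closed path survives in the quotient, and then so do all its
  powers.\<close>

definition cyclic :: "'e list \<Rightarrow> bool" where
  "cyclic l \<longleftrightarrow> l \<noteq> [] \<and> successively follows l \<and> follows (last l) (hd l)"

definition list_path :: "'e list \<Rightarrow> ('v, 'e) quiver_path" where
  "list_path l = (tail Q (hd l), l)"

lemma snd_list_path [simp]: "snd (list_path l) = l"
  by (simp add: list_path_def)

lemma inj_list_path [simp]: "list_path l = list_path l' \<longleftrightarrow> l = l'"
  by (auto simp: list_path_def)

text \<open>A list with one entry satisfies \<open>successively\<close> vacuously, hence the bound
  on the length.\<close>

lemma successively_follows_arcs:
  "successively follows l \<Longrightarrow> length l \<ge> 2 \<Longrightarrow> set l \<subseteq> arcs Q"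
proof (induction l rule: induct_list012)
  case (3 x y zs)
  then show ?case by (cases zs) (auto dest: follows_arcs)
qed auto

lemma follows_list_eq:
  "length l = length l' \<Longrightarrow> successively follows l \<Longrightarrow> successively follows l' \<Longrightarrow> hd l = hd l' \<Longrightarrow> l = l'"
  by (rule successively_functional_eq[OF follows_right_unique])

lemma cyclic_arcs: "cyclic l \<Longrightarrow> set l \<subseteq> arcs Q"
  using successively_follows_arcs[of l]
  by (cases l; cases "tl l") (auto simp: cyclic_def dest: follows_arcs)

lemma cyclic_list_path: "cyclic l \<Longrightarrow> list_path l \<in> B"
  using cyclic_arcs[of l] by (simp add: list_path_def basis_iff cyclic_def)

lemma basis_list_path: "p \<in> B \<Longrightarrow> snd p \<noteq> [] \<Longrightarrow> p = list_path (snd p)"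
  by (cases p) (simp add: list_path_def basis_iff)

lemma cyclic_rotate1:
  assumes "cyclic l"
  shows "cyclic (rotate1 l)"
proof (cases l)
  case (Cons x xs)
  then have "successively follows (xs @ [x])"
    using assms by (cases "xs = []") (auto simp: cyclic_def successively_append_iff successively_Cons)
  then show ?thesis using assms Cons
    by (cases "xs = []") (auto simp: cyclic_def successively_Cons)
qed (use assms in \<open>simp add: cyclic_def\<close>)

lemma cyclic_rotate: "cyclic l \<Longrightarrow> cyclic (rotate n l)"
  by (induction n) (simp_all add: cyclic_rotate1)

lemma cyclic_obtain_rotation:
  assumes "cyclic l" "a \<in> set l"
  obtains n where "cyclic (rotate n l)" "hd (rotate n l) = a"
  using rotate_hd_eq[OF assms(2)] cyclic_rotate[OF assms(1)] by blast

lemma cyclic_predecessor: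
  assumes "cyclic l" "follows x (hd l)"
  shows "x = last l"
  using assms follows_left_unique by (auto simp: cyclic_def)

text \<open>After a rotation that puts \<open>x\<close> in front, its successor is the second entry,
  or \<open>x\<close> itself if the cycle is a loop; no other successor exists.\<close>

lemma cyclic_closed:
  assumes "cyclic l" "x \<in> set l"
  shows "\<exists>z. follows x z" and "follows x z \<Longrightarrow> z \<in> set l"
proof -
  obtain n where n: "cyclic (rotate n l)" "hd (rotate n l) = x"
    using assms by (rule cyclic_obtain_rotation)
  obtain xs where xs: "rotate n l = x # xs"
    using n by (cases "rotate n l") (auto simp: cyclic_def)
  have set: "set l = set (x # xs)" using arg_cong[OF xs, of set] by simp
  have "\<exists>z \<in> set (x # xs). follows x z"
    using n(1) unfolding xs by (cases xs) (auto simp: cyclic_def)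
  then show "\<exists>z. follows x z" "follows x z \<Longrightarrow> z \<in> set l"
    using follows_right_unique unfolding set by blast+
qed

text \<open>A sequence that starts on a cycle cannot leave it. This is what later keeps finite
  maximal paths away from cycles.\<close>

lemma cyclic_forward_closed:
  assumes "cyclic u" "successively follows l" "l \<noteq> []" "hd l \<in> set u"
  shows "last l \<in> set u"
  using assms(2-)
proof (induction l)
  case (Cons x xs)
  then show ?case
    by (cases xs) (auto dest: cyclic_closed(2)[OF assms(1)])
qed simp

text \<open>Determinism forces \<open>w\<close> to run along \<open>u\<close>; if it were longer,
  its next entry would be the first arrow again. This is the bound behind the length of
  \<open>gamma_r\<close>.\<close>

lemma cyclic_distinct_longest:
  assumes "cyclic u" "successively follows w" "distinct w" "w \<noteq> []" "hd w = hd u"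
  shows "length w \<le> length u"
proof (rule ccontr)
  assume "\<not> length w \<le> length u"
  then have len: "length u < length w" by simp
  let ?n = "length u"
  have u: "u \<noteq> []" using assms(1) by (simp add: cyclic_def)
  have "successively follows (take ?n w)"
    using assms(2) append_take_drop_id[of ?n w] successively_append_iff by metis
  then have eq: "take ?n w = u"
    using assms len u by (intro follows_list_eq) (auto simp: cyclic_def)
  obtain k where k: "?n = Suc k" using u by (cases ?n) auto
  have "w ! k = take ?n w ! k" using k by simp
  also have "\<dots> = last u" unfolding eq using u k by (simp add: last_conv_nth)
  finally have "follows (w ! k) (hd u)" using assms(1) by (simp add: cyclic_def)
  moreover have "follows (w ! k) (w ! Suc k)"
    using successively_nth[OF assms(2)] len k by simp
  ultimately have "w ! Suc k = hd u" using follows_right_unique by blast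
  also have "\<dots> = w ! 0" using assms by (simp add: hd_conv_nth)
  finally show False using nth_eq_iff_index_eq[OF assms(3), of "Suc k" 0] assms(4) len k by simp
qed

text \<open>Each cycle bounds the length of the other by \<open>cyclic_distinct_longest\<close>, and
  length together with first arrow determines the list.\<close>

lemma cyclic_distinct_eq:
  assumes "cyclic u" "distinct u" "cyclic w" "distinct w" "hd u = hd w"
  shows "u = w"
proof (rule follows_list_eq)
  have "length w \<le> length u" "length u \<le> length w"
    using assms by (auto intro!: cyclic_distinct_longest simp: cyclic_def)
  then show "length u = length w" by simp
qed (use assms in \<open>simp_all add: cyclic_def\<close>)

text \<open>A repeated arrow yields a rotation fixing \<^term>\<open>l\<close>, so two complementary segments of \<^term>\<open>l\<close>
  commute and are powers of a common sequence.\<close>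

lemma cyclic_not_distinct_power:
  assumes "cyclic l" "\<not> distinct l"
  obtains zs k where "k > 1" "l = concat (replicate k zs)" "cyclic zs"
proof -
  obtain i j where ij: "i < j" "j < length l" "l ! i = l ! j"
    using assms(2) by (metis distinct_conv_nth nat_neq_iff)
  have ne: "l \<noteq> []" using assms(1) by (simp add: cyclic_def)
  have "rotate i l = rotate j l"
  proof (rule follows_list_eq)
    show "hd (rotate i l) = hd (rotate j l)"
      using ij ne by (simp add: hd_rotate_conv_nth)
  qed (use cyclic_rotate[OF assms(1)] in \<open>auto simp: cyclic_def\<close>)
  then have "rotate i (rotate (j - i) l) = rotate i l"
    using ij by (simp add: rotate_rotate)
  then have "rotate (j - i) l = l"
    using rotate_rotate_inverse[of i] by (metis add.commute rotate_rotate)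
  then have "drop (j - i) l @ take (j - i) l = l"
    using ij by (simp add: rotate_drop_take)
  then have "drop (j - i) l @ take (j - i) l = take (j - i) l @ drop (j - i) l" by simp
  then obtain m n zs where mn: "concat (replicate m zs) = drop (j - i) l"
    "concat (replicate n zs) = take (j - i) l"
    using comm_append_are_replicate by blast
  \<comment> \<open>Both segments are nonempty, so both exponents are positive and the total
    exponent is at least 2.\<close>
  have "drop (j - i) l \<noteq> []" "take (j - i) l \<noteq> []" using ij by auto
  with mn have "m \<noteq> 0" "n \<noteq> 0" and pos: "zs \<noteq> []"
    by (metis concat.simps(1) replicate_0, metis concat.simps(1) replicate_0, metis concat_replicate_trivial)
  have l: "l = concat (replicate (n + m) zs)"
    using mn by (metis append_take_drop_id concat_append replicate_add)
  obtain n' m' where nm: "n = Suc n'" "m = Suc m'"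
    using \<open>m \<noteq> 0\<close> \<open>n \<noteq> 0\<close> by (metis not0_implies_Suc)
  \<comment> \<open>With two or more copies, \<open>zs\<close> stands both at the beginning and at
    the end of \<open>l\<close>, so the closing pair of \<open>l\<close> is also the closing pair of
    \<open>zs\<close>.\<close>
  have "replicate (n + m) zs = zs # replicate (n' + m') zs @ [zs]"
    by (simp add: nm replicate_append_same)
  then have "l = zs @ concat (replicate (n' + m') zs) @ zs"
    using l by simp
  then have "hd l = hd zs" "last l = last zs" "successively follows zs"
    using pos assms(1) by (auto simp: cyclic_def successively_append_iff)
  then have "cyclic zs" using assms(1) pos by (simp add: cyclic_def)
  then show thesis using that[of "n + m" zs] l nm by simp
qed

text \<open>As long as an arrow repeats, the list is a proper power of a shorter cyclic list;
  induction on the length ends at a repetition-free root, and the exponents multiply.\<close>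

lemma cyclic_power:
  assumes "cyclic l"
  obtains u n where "cyclic u" "distinct u" "n > 0" "l = concat (replicate n u)"
  using assms
proof (induction "length l" arbitrary: l thesis rule: less_induct)
  case less
  show ?case
  proof (cases "distinct l")
    case True
    then show ?thesis using less.prems(1)[of l 1] less.prems(2) by simp
  next
    case False
    then obtain zs k where zs: "k > 1" "l = concat (replicate k zs)" "cyclic zs"
      using cyclic_not_distinct_power less.prems(2) by blast
    have "length l = k * length zs" unfolding zs by (induction k) auto
    moreover have "length zs > 0" using zs by (simp add: cyclic_def)
    ultimately have "length zs < length l" using zs by simp
    then obtain u n where u: "cyclic u" "distinct u" "n > 0" "zs = concat (replicate n u)"
      using less.hyps[of zs] zs by blast
    have "l = concat (replicate (k * n) u)"
      unfolding zs u by (induction k) (simp_all add: replicate_add)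
    then show ?thesis using less.prems(1)[of u "k * n"] u zs by simp
  qed
qed

lemma cyclic_concat_replicate:
  assumes "cyclic u" "n > 0"
  shows "cyclic (concat (replicate n u))" "hd (concat (replicate n u)) = hd u"
    "last (concat (replicate n u)) = last u"
proof -
  have "cyclic (concat (replicate n u)) \<and> hd (concat (replicate n u)) = hd u \<and>
    last (concat (replicate n u)) = last u"
    using assms(2)
  proof (induction n)
    case (Suc n)
    then show ?case using assms(1)
      by (cases n) (auto simp: cyclic_def successively_append_iff)
  qed simp
  then show "cyclic (concat (replicate n u))" "hd (concat (replicate n u)) = hd u"
    "last (concat (replicate n u)) = last u" by auto
qed

end

section \<open>Maximal paths\<close>

context gentle_quiver
begin

lemma basis_successively: "p \<in> B \<Longrightarrow> successively follows (snd p)"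
  by (cases p; cases "snd p = []") (simp_all add: basis_iff)

lemma quiver_cycle_iff:
  "quiver_cycle Q p \<longleftrightarrow> p \<in> quiver_paths Q \<and> snd p \<noteq> [] \<and> tail Q (hd (snd p)) = head Q (last (snd p))"
  by (cases p)
    (auto simp: quiver_cycle_def path_source_def path_target_nonempty quiver_paths_iff[OF wf])

lemma cyclic_quiver_cycle: "cyclic l \<Longrightarrow> quiver_cycle Q (list_path l)"
  using cyclic_list_path[of l] basis_subset_paths
  by (auto simp: quiver_cycle_iff cyclic_def follows_def)

text \<open>For a cycle whose square survives, primitive means without repeated arrows: a repetition
  makes it a proper power, and a proper power repeats every arrow of its root.\<close>

lemma infinite_maximal_paths_eq:
  "infinite_maximal_paths Q I = {rotations Q (list_path l) | l. cyclic l \<and> distinct l}"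
proof (intro equalityI subsetI)
  fix \<gamma>
  assume "\<gamma> \<in> infinite_maximal_paths Q I"
  then obtain c where \<gamma>: "\<gamma> = rotations Q c" and prim: "primitive_cycle Q c"
    and c: "path_elt (path_power c 2) \<notin> I"
    by (auto simp: infinite_maximal_paths_def)
  obtain v l where vl: "c = (v, l)" by force
  have cycle: "quiver_cycle Q c" using prim by (simp add: primitive_cycle_def)
  have path: "(v, l) \<in> quiver_paths Q" and ne: "l \<noteq> []" and closed: "tail Q (hd l) = head Q (last l)"
    using cycle by (auto simp: quiver_cycle_iff vl)
  \<comment> \<open>In the doubled list the pair in the middle is the last arrow followed by the
    first, so survival of the square supplies the closing condition of
    \<open>cyclic\<close>.\<close>
  have "path_power c 2 = (v, l @ l)" by (simp add: path_power_def vl numeral_2_eq_2)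
  moreover have "(v, l @ l) \<in> quiver_paths Q"
    using path ne closed by (auto simp: quiver_paths_iff[OF wf] successively_append_iff)
  ultimately have "(v, l @ l) \<in> B" using c path_elt_in_I_iff by metis
  then have cyc: "cyclic l" and v: "v = tail Q (hd l)"
    using ne by (simp_all add: basis_iff cyclic_def successively_append_iff)
  have "distinct l"
  proof (rule ccontr)
    assume "\<not> distinct l"
    then obtain zs k where "k > 1" "l = concat (replicate k zs)" "cyclic zs"
      using cyclic_not_distinct_power[OF cyc] by metis
    moreover from this have "hd l = hd zs" using cyclic_concat_replicate(2)[of zs k] by simp
    ultimately have "quiver_cycle Q (list_path zs)" "c = path_power (list_path zs) k" "k > 1"
      using cyclic_quiver_cycle by (simp_all add: vl v path_power_def) (simp add: list_path_def)
    then show False using prim unfolding primitive_cycle_def by blast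
  qed
  moreover have "c = list_path l" by (simp add: vl v list_path_def)
  ultimately show "\<gamma> \<in> {rotations Q (list_path l) | l. cyclic l \<and> distinct l}"
    using \<gamma> cyc by blast
next
  fix \<gamma>
  assume "\<gamma> \<in> {rotations Q (list_path l) | l. cyclic l \<and> distinct l}"
  then obtain l where l: "cyclic l" "distinct l" and \<gamma>: "\<gamma> = rotations Q (list_path l)"
    by blast
  have "primitive_cycle Q (list_path l)"
    unfolding primitive_cycle_def
  proof (intro conjI notI cyclic_quiver_cycle l)
    assume "\<exists>c' k. quiver_cycle Q c' \<and> 1 < k \<and> list_path l = path_power c' k"
    then obtain c' k where "quiver_cycle Q c'" "1 < k" "list_path l = path_power c' k" by blast
    then have "snd c' \<noteq> []" "l = concat (replicate k (snd c'))"
      by (auto simp: quiver_cycle_def list_path_def path_power_def)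
    moreover obtain j where "k = Suc (Suc j)" using \<open>1 < k\<close> by (metis One_nat_def less_iff_Suc_add add_Suc)
    ultimately show False using l(2) by auto
  qed
  moreover have "path_power (list_path l) 2 \<in> B"
  proof -
    have "path_power (list_path l) 2 = list_path (concat (replicate 2 l))"
      using cyclic_concat_replicate(2)[OF l(1), of 2] by (simp add: path_power_def list_path_def)
    then show ?thesis using cyclic_list_path[OF cyclic_concat_replicate(1)[OF l(1), of 2]] by simp
  qed
  ultimately show "\<gamma> \<in> infinite_maximal_paths Q I"
    unfolding infinite_maximal_paths_def \<gamma> basis_paths_def by blast
qed

section \<open>Rotation classes of cycles\<close>

lemma rotations_list_path: "rotations Q (list_path l) = range (\<lambda>n. list_path (rotate n l))"
  by (auto simp: rotations_def list_path_def)

lemma rotations_rotate: "rotations Q (list_path (rotate n l)) = rotations Q (list_path l)"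
proof -
  have "rotations Q (list_path (rotate m k)) \<subseteq> rotations Q (list_path k)" for m k
    by (auto simp: rotations_list_path rotate_rotate)
  from this[of n l] this[of _ "rotate n l"] rotate_rotate_inverse[of n l] show ?thesis
    by (metis subset_antisym)
qed

text \<open>Any member may serve as the representative of its class, since rotating preserves both
  cyclicity and distinctness.\<close>

lemma mem_infinite_maximal_path:
  assumes "\<gamma> \<in> infinite_maximal_paths Q I" "c \<in> \<gamma>"
  obtains l where "c = list_path l" "cyclic l" "distinct l" "\<gamma> = rotations Q (list_path l)"
proof -
  obtain l where l: "cyclic l" "distinct l" "\<gamma> = rotations Q (list_path l)"
    using assms(1) by (auto simp: infinite_maximal_paths_eq)
  then obtain n where n: "c = list_path (rotate n l)" using assms(2) by (auto simp: rotations_list_path)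
  show thesis
    by (rule that[of "rotate n l"]) (use l n in \<open>simp_all add: cyclic_rotate rotations_rotate\<close>)
qed

lemma infinite_maximal_path_nonempty: "\<gamma> \<in> infinite_maximal_paths Q I \<Longrightarrow> \<gamma> \<noteq> {}"
  by (auto simp: infinite_maximal_paths_eq rotations_list_path)

lemma infinite_maximal_path_rotate1:
  assumes "\<gamma> \<in> infinite_maximal_paths Q I"
  shows "list_path (rotate1 l) \<in> \<gamma> \<longleftrightarrow> list_path l \<in> \<gamma>"
proof -
  have rot: "rotations Q (list_path (rotate1 l)) = rotations Q (list_path l)"
    using rotations_rotate[of 1 l] by simp
  have self: "list_path l \<in> rotations Q (list_path l)" for l
    unfolding rotations_list_path by (rule range_eqI[of _ _ 0]) simp
  show ?thesis
  proof
    assume "list_path (rotate1 l) \<in> \<gamma>"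
    then have "\<gamma> = rotations Q (list_path (rotate1 l))"
      using mem_infinite_maximal_path[OF assms] by metis
    then show "list_path l \<in> \<gamma>" using rot self[of l] by auto
  next
    assume "list_path l \<in> \<gamma>"
    then have "\<gamma> = rotations Q (list_path l)"
      using mem_infinite_maximal_path[OF assms] by metis
    then show "list_path (rotate1 l) \<in> \<gamma>" using rot self[of "rotate1 l"] by auto
  qed
qed

text \<open>Rotating both cycles to start at the common arrow makes them equal by
  \<open>cyclic_distinct_eq\<close>.\<close>

lemma infinite_maximal_path_eqI:
  assumes "\<gamma> \<in> infinite_maximal_paths Q I" "\<gamma>' \<in> infinite_maximal_paths Q I"
    and "list_path l \<in> \<gamma>" "list_path l' \<in> \<gamma>'" "a \<in> set l" "a \<in> set l'"
  shows "\<gamma> = \<gamma>'"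
proof -
  have l: "cyclic l" "distinct l" "\<gamma> = rotations Q (list_path l)"
    using mem_infinite_maximal_path[OF assms(1,3)] by auto
  have l': "cyclic l'" "distinct l'" "\<gamma>' = rotations Q (list_path l')"
    using mem_infinite_maximal_path[OF assms(2,4)] by auto
  obtain n where n: "cyclic (rotate n l)" "hd (rotate n l) = a"
    using cyclic_obtain_rotation[OF l(1) assms(5)] .
  obtain n' where n': "cyclic (rotate n' l')" "hd (rotate n' l') = a"
    using cyclic_obtain_rotation[OF l'(1) assms(6)] .
  have "rotate n l = rotate n' l'"
    using n n' l l' by (intro cyclic_distinct_eq) simp_all
  then show ?thesis using l(3) l'(3) rotations_rotate by metis
qed

text \<open>A product with an arrow lies in the ideal for one of two reasons, mismatched endpoints
  or a forbidden pair at the junction; \<open>follows\<close> fails in exactly these cases.\<close>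

lemma finite_maximal_path_iff:
  assumes "l \<noteq> []"
  shows "(v, l) \<in> finite_maximal_paths Q I \<longleftrightarrow>
    (v, l) \<in> B \<and> (\<forall>a. \<not> follows (last l) a \<and> \<not> follows a (hd l))"
proof -
  have "(path_elt (v, l) \<otimes>\<^bsub>P\<^esub> path_elt (arrow_path Q a) \<in> I \<longleftrightarrow> \<not> follows (last l) a) \<and>
      (path_elt (arrow_path Q a) \<otimes>\<^bsub>P\<^esub> path_elt (v, l) \<in> I \<longleftrightarrow> \<not> follows a (hd l))"
    if B: "(v, l) \<in> B" and a: "a \<in> arcs Q" for a
  proof -
    have l: "v = tail Q (hd l)" "set l \<subseteq> arcs Q" "successively follows l"
      using B assms by (simp_all add: basis_iff)
    have path: "(v, l) \<in> quiver_paths Q" using B basis_subset_paths by blast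
    have arrow: "arrow_path Q a \<in> quiver_paths Q"
      using a by (simp add: arrow_path_def quiver_paths_iff[OF wf])
    have zero: "0 \<in> I" by (simp add: mem_I_iff)
    have "path_elt (v, l) \<otimes>\<^bsub>P\<^esub> path_elt (arrow_path Q a) \<in> I \<longleftrightarrow> \<not> follows (last l) a"
    proof (cases "path_target Q (v, l) = path_source (arrow_path Q a)")
      case True
      then have "path_comp (v, l) (arrow_path Q a) \<in> quiver_paths Q"
        using path arrow by (intro path_comp_in_quiver_paths[OF wf])
      moreover have "path_comp (v, l) (arrow_path Q a) \<in> B \<longleftrightarrow> follows (last l) a"
        using l a assms by (simp add: path_comp_def arrow_path_def basis_iff successively_append_iff)
      ultimately show ?thesis using True by (simp add: path_elt_in_I_iff)
    next
      case False
      then show ?thesis using zero assms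
        by (auto simp: follows_def path_target_nonempty path_source_def arrow_path_def)
    qed
    moreover have "path_elt (arrow_path Q a) \<otimes>\<^bsub>P\<^esub> path_elt (v, l) \<in> I \<longleftrightarrow> \<not> follows a (hd l)"
    proof (cases "path_target Q (arrow_path Q a) = path_source (v, l)")
      case True
      then have "path_comp (arrow_path Q a) (v, l) \<in> quiver_paths Q"
        using path arrow by (intro path_comp_in_quiver_paths[OF wf])
      moreover have "path_comp (arrow_path Q a) (v, l) \<in> B \<longleftrightarrow> follows a (hd l)"
        using l a assms by (simp add: path_comp_def arrow_path_def basis_iff successively_Cons)
      ultimately show ?thesis using True by (simp add: path_elt_in_I_iff)
    next
      case False
      then show ?thesis using zero assms l
        by (auto simp: follows_def path_target_nonempty path_source_def arrow_path_def)
    qed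
    ultimately show ?thesis ..
  qed
  then show ?thesis
    unfolding finite_maximal_paths_def using follows_arcs by blast
qed

text \<open>From a common arrow on, the finite path would stay on the cycle, so its last arrow would
  have a successor, against maximality.\<close>

lemma cyclic_not_finite_maximal:
  assumes "cyclic u" "a \<in> set u" "p \<in> finite_maximal_paths Q I"
  shows "a \<notin> set (snd p)"
proof
  assume a: "a \<in> set (snd p)"
  obtain v l where p: "p = (v, l)" by force
  have ne: "l \<noteq> []" using a p by auto
  have fmp: "(v, l) \<in> B" "\<And>b. \<not> follows (last l) b"
    using assms(3) ne by (auto simp: p finite_maximal_path_iff)
  obtain xs ys where l: "l = xs @ a # ys" using a p by (auto simp: in_set_conv_decomp)
  have "successively follows (a # ys)"
    using fmp(1) ne by (simp add: basis_iff l successively_append_iff)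
  then have "last (a # ys) \<in> set u"
    using assms(1,2) by (intro cyclic_forward_closed) auto
  then obtain b where "follows (last (a # ys)) b"
    using cyclic_closed(1)[OF assms(1)] by blast
  then show False using fmp(2)[of b] by (simp add: l)
qed

text \<open>A longest repetition-free sequence through \<^term>\<open>a\<close> can be prolonged only by closing it up.\<close>

lemma arrow_in_maximal_path:
  assumes "a \<in> arcs Q"
  shows "(\<exists>u. cyclic u \<and> distinct u \<and> a \<in> set u) \<or> (\<exists>p\<in>finite_maximal_paths Q I. a \<in> set (snd p))"
proof -
  let ?D = "{l. set l \<subseteq> arcs Q \<and> distinct l \<and> successively follows l \<and> a \<in> set l}"
  have bound: "\<forall>l. l \<in> ?D \<longrightarrow> length l < Suc (card (arcs Q))"
    using card_mono[OF finite_arcs] by (auto simp: less_Suc_eq_le simp flip: distinct_card)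
  have mem: "[a] \<in> ?D" using assms by simp
  obtain l where "l \<in> ?D \<and> (\<forall>k. k \<in> ?D \<longrightarrow> length k \<le> length l)"
    using ex_has_greatest_nat[of "\<lambda>l. l \<in> ?D", OF mem bound] by (elim exE)
  then have l: "l \<in> ?D" and max: "\<And>k. k \<in> ?D \<Longrightarrow> length k \<le> length l" by blast+
  have ne: "l \<noteq> []" using l by auto
  show ?thesis
  proof (cases "follows (last l) (hd l)")
    case True
    then have "cyclic l" using l ne by (simp add: cyclic_def)
    then show ?thesis using l by blast
  next
    case False
    have "\<not> follows (last l) b" for b
    proof
      assume b: "follows (last l) b"
      show False
      proof (cases "b \<in> set l")
        case True
        then obtain xs ys where xs: "l = xs @ b # ys" by (auto simp: in_set_conv_decomp)
        show False
        proof (cases "xs = []")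
          case True
          then show False using False b xs by simp
        next
          case False': False
          \<comment> \<open>The arrow preceding \<open>b\<close> inside \<open>l\<close> and the
            last arrow of \<open>l\<close> are both predecessors of \<open>b\<close>; they coincide
            and contradict distinctness.\<close>
          then have "follows (last xs) b" using l xs by (simp add: successively_append_iff)
          then have "last xs = last l" using b follows_left_unique by blast
          moreover have "last l \<in> set (b # ys)" using xs by simp
          moreover have "last xs \<in> set xs" using False' by simp
          ultimately show False using l xs by auto
        qed
      next
        case False
        then have "l @ [b] \<in> ?D" using l b ne by (auto simp: successively_append_iff dest: follows_arcs)
        then show False using max[of "l @ [b]"] by simp
      qed
    qed
    moreover have "\<not> follows b (hd l)" for b
    proof
      assume b: "follows b (hd l)"
      show False
      proof (cases "b \<in> set l")
        case True
        then obtain xs ys where xs: "l = xs @ b # ys" by (auto simp: in_set_conv_decomp)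
        show False
        proof (cases "ys = []")
          case True
          then show False using False b xs by simp
        next
          case False': False
          \<comment> \<open>Mirror image: the arrow after \<open>b\<close> inside \<open>l\<close>
            and the first arrow of \<open>l\<close> are both successors of \<open>b\<close>.\<close>
          then have "follows b (hd ys)" using l xs by (cases ys) (auto simp: successively_append_iff)
          then have "hd ys = hd l" using b follows_right_unique by blast
          moreover have "hd l \<in> set (xs @ [b])" using xs by (cases xs) auto
          moreover have "hd ys \<in> set ys" using False' by simp
          ultimately show False using l xs by auto
        qed
      next
        case False
        then have "b # l \<in> ?D" using l b ne by (auto simp: successively_Cons dest: follows_arcs)
        then show False using max[of "b # l"] by simp
      qed
    qed
    ultimately have "list_path l \<in> finite_maximal_paths Q I"
      using l ne by (simp add: list_path_def finite_maximal_path_iff basis_iff)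
    then show ?thesis using l by (intro disjI2 bexI[of _ "list_path l"]) auto
  qed
qed

text \<open>Justifies the definite description in \<open>maximal_path_of\<close>. Two finite
  candidates agree by unique prolongation in both directions, two infinite ones by a common
  rotation, and a finite and an infinite one cannot share an arrow.\<close>

lemma unique_maximal_path:
  assumes "a \<in> arcs Q"
  shows "\<exists>!\<gamma>. \<gamma> \<in> maximal_paths Q I \<and> lies_in a \<gamma>"
proof (rule ex_ex1I)
  show "\<exists>\<gamma>. \<gamma> \<in> maximal_paths Q I \<and> lies_in a \<gamma>"
    using arrow_in_maximal_path[OF assms]
  proof (elim disjE exE bexE conjE)
    fix u
    assume u: "cyclic u" "distinct u" "a \<in> set u"
    show ?thesis
    proof (intro exI conjI)
      show "Infinite_Path (rotations Q (list_path u)) \<in> maximal_paths Q I"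
        unfolding maximal_paths_def infinite_maximal_paths_eq using u by blast
      show "lies_in a (Infinite_Path (rotations Q (list_path u)))"
        using u by (auto simp: rotations_list_path)
    qed
  next
    fix p
    assume "p \<in> finite_maximal_paths Q I" "a \<in> set (snd p)"
    then show ?thesis by (intro exI[of _ "Finite_Path p"]) (simp add: maximal_paths_def)
  qed
next
  fix \<gamma> \<gamma>'
  assume \<gamma>: "\<gamma> \<in> maximal_paths Q I \<and> lies_in a \<gamma>" and \<gamma>': "\<gamma>' \<in> maximal_paths Q I \<and> lies_in a \<gamma>'"
  have fin: "\<exists>p. \<delta> = Finite_Path p \<and> p \<in> finite_maximal_paths Q I \<and> a \<in> set (snd p)"
    if "\<delta> \<in> maximal_paths Q I \<and> lies_in a \<delta>" "\<nexists>C. \<delta> = Infinite_Path C" for \<delta>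
    using that by (auto simp: maximal_paths_def)
  have inf: "\<exists>C l. \<delta> = Infinite_Path C \<and> C \<in> infinite_maximal_paths Q I \<and> list_path l \<in> C \<and>
      cyclic l \<and> a \<in> set l"
    if \<delta>: "\<delta> \<in> maximal_paths Q I \<and> lies_in a \<delta>" "\<nexists>p. \<delta> = Finite_Path p" for \<delta>
  proof -
    obtain C where C: "\<delta> = Infinite_Path C" "C \<in> infinite_maximal_paths Q I"
      using \<delta> by (auto simp: maximal_paths_def)
    then obtain c where c: "c \<in> C" "a \<in> set (snd c)" using \<delta> by auto
    then obtain l where "c = list_path l" "cyclic l"
      using mem_infinite_maximal_path[OF C(2)] by metis
    then show ?thesis using C c by auto
  qed
  show "\<gamma> = \<gamma>'"
  proof (cases \<gamma>; cases \<gamma>')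
    fix p p'
    assume p: "\<gamma> = Finite_Path p" "\<gamma>' = Finite_Path p'"
    then have fmp: "p \<in> finite_maximal_paths Q I" "p' \<in> finite_maximal_paths Q I"
      and a: "a \<in> set (snd p)" "a \<in> set (snd p')"
      using fin[OF \<gamma>] fin[OF \<gamma>'] by simp_all
    obtain v l v' l' where vl: "p = (v, l)" "p' = (v', l')" by force
    have ne: "l \<noteq> []" "l' \<noteq> []" using a vl by auto
    have "l = l'"
      using fmp a ne
      by (intro successively_split_maximal_eq[of follows l l' a] follows_right_unique follows_left_unique)
        (simp_all add: vl finite_maximal_path_iff basis_iff)
    then show ?thesis using p vl fmp ne by (simp add: finite_maximal_path_iff basis_iff)
  next
    fix p C
    assume eq: "\<gamma> = Finite_Path p" "\<gamma>' = Infinite_Path C"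
    then obtain l where "cyclic l" "a \<in> set l" using inf[OF \<gamma>'] by auto
    then show ?thesis using fin[OF \<gamma>] eq cyclic_not_finite_maximal[of l a p] by auto
  next
    fix p C
    assume eq: "\<gamma> = Infinite_Path C" "\<gamma>' = Finite_Path p"
    then obtain l where "cyclic l" "a \<in> set l" using inf[OF \<gamma>] by auto
    then show ?thesis using fin[OF \<gamma>'] eq cyclic_not_finite_maximal[of l a p] by auto
  next
    fix C C'
    assume C: "\<gamma> = Infinite_Path C" "\<gamma>' = Infinite_Path C'"
    then obtain l l' where "C \<in> infinite_maximal_paths Q I" "C' \<in> infinite_maximal_paths Q I"
      "list_path l \<in> C" "list_path l' \<in> C'" "a \<in> set l" "a \<in> set l'"
      using inf[OF \<gamma>] inf[OF \<gamma>'] by auto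
    then show ?thesis using C infinite_maximal_path_eqI by metis
  qed
qed

section \<open>The element attached to an infinite maximal path\<close>

lemma maximal_path_of_eq_Infinite_iff:
  assumes "a \<in> arcs Q"
  shows "maximal_path_of Q I a = Infinite_Path \<gamma> \<longleftrightarrow>
    \<gamma> \<in> infinite_maximal_paths Q I \<and> (\<exists>c\<in>\<gamma>. a \<in> set (snd c))"
proof
  assume "maximal_path_of Q I a = Infinite_Path \<gamma>"
  then show "\<gamma> \<in> infinite_maximal_paths Q I \<and> (\<exists>c\<in>\<gamma>. a \<in> set (snd c))"
    using theI'[OF unique_maximal_path[OF assms]]
    by (auto simp: maximal_path_of_def maximal_paths_def)
next
  assume "\<gamma> \<in> infinite_maximal_paths Q I \<and> (\<exists>c\<in>\<gamma>. a \<in> set (snd c))"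
  then show "maximal_path_of Q I a = Infinite_Path \<gamma>"
    unfolding maximal_path_of_def
    by (intro the1_equality unique_maximal_path assms) (auto simp: maximal_paths_def)
qed

text \<open>The cycle attains the maximal length allowed by \<open>cyclic_distinct_longest\<close>,
  and determinism leaves no second sequence of that length with the same first arrow.\<close>

lemma gamma_r_eq:
  assumes "cyclic u" "distinct u"
  shows "gamma_r Q I (hd u) = list_path u"
  unfolding gamma_r_def is_arg_max_linorder
proof (rule the_equality)
  let ?P = "\<lambda>p. p \<in> B \<and> snd p \<noteq> [] \<and> hd (snd p) = hd u \<and> distinct (snd p)"
  have len: "length (snd p) \<le> length u" if p: "?P p" for p
    using p basis_successively[of p] by (intro cyclic_distinct_longest[OF assms(1)]) simp_all
  have u: "?P (list_path u)"
    using assms cyclic_list_path by (simp add: cyclic_def)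
  with len show "?P (list_path u) \<and> (\<forall>p. ?P p \<longrightarrow> length (snd p) \<le> length (snd (list_path u)))"
    by simp
  fix p
  assume p: "?P p \<and> (\<forall>q. ?P q \<longrightarrow> length (snd q) \<le> length (snd p))"
  have "length u \<le> length (snd p)" using p[THEN conjunct2, rule_format, OF u] by simp
  with len[of p] p have "length (snd p) = length u" by (simp add: order_antisym)
  then have "snd p = u"
    using p assms basis_successively[of p] by (intro follows_list_eq) (simp_all add: cyclic_def)
  then show "p = list_path u" using p basis_list_path[of p] by simp
qed

text \<open>A repetition-free cycle has exactly one rotation starting at each of its arrows, so
  \<open>gamma_r\<close> is a bijection from the arrows of the class to its members, with the first
  arrow as inverse.\<close>

lemma m_element_eq:
  assumes "\<gamma> \<in> infinite_maximal_paths Q I"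
  shows "m_element Q I \<gamma> = cls (\<Sum>c\<in>\<gamma>. path_elt c)"
proof -
  let ?S = "{a \<in> arcs Q. maximal_path_of Q I a = Infinite_Path \<gamma>}"
  have bij: "bij_betw (gamma_r Q I) ?S \<gamma>"
  proof (rule bij_betwI[where g = "\<lambda>c. hd (snd c)"])
    have *: "\<exists>l. cyclic l \<and> distinct l \<and> hd l = a \<and> list_path l \<in> \<gamma>" if a: "a \<in> ?S" for a
    proof -
      from a obtain c where c: "c \<in> \<gamma>" "a \<in> set (snd c)"
        by (auto simp: maximal_path_of_eq_Infinite_iff)
      obtain l where l: "c = list_path l" "cyclic l" "distinct l" "\<gamma> = rotations Q (list_path l)"
        using mem_infinite_maximal_path[OF assms c(1)] .
      obtain n where n: "cyclic (rotate n l)" "hd (rotate n l) = a"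
        using cyclic_obtain_rotation[OF l(2), of a] c l by auto
      have "list_path (rotate n l) \<in> \<gamma>" unfolding l(4) rotations_list_path by blast
      with n l(3) show ?thesis by (intro exI[of _ "rotate n l"]) simp
    qed
    show "gamma_r Q I \<in> ?S \<rightarrow> \<gamma>"
      using * gamma_r_eq by fastforce
    show "hd (snd (gamma_r Q I a)) = a" if "a \<in> ?S" for a
      using *[OF that] gamma_r_eq by fastforce
    have **: "gamma_r Q I (hd (snd c)) = c \<and> hd (snd c) \<in> ?S" if c: "c \<in> \<gamma>" for c
    proof -
      obtain l where l: "c = list_path l" "cyclic l" "distinct l"
        using mem_infinite_maximal_path[OF assms c] .
      then have "hd l \<in> set l" "hd l \<in> arcs Q" using cyclic_arcs[of l] by (auto simp: cyclic_def)
      then have "hd l \<in> ?S"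
        using assms c l by (auto simp: maximal_path_of_eq_Infinite_iff intro!: bexI[of _ "list_path l"])
      then show ?thesis using l by (simp add: gamma_r_eq)
    qed
    show "(\<lambda>c. hd (snd c)) \<in> \<gamma> \<rightarrow> ?S" using ** by blast
    show "gamma_r Q I (hd (snd c)) = c" if "c \<in> \<gamma>" for c using ** that by blast
  qed
  have path: "Poly_Mapping.keys (path_elt (gamma_r Q I a) :: _ \<Rightarrow>\<^sub>0 'k) \<subseteq> quiver_paths Q" if "a \<in> ?S" for a
  proof -
    have "gamma_r Q I a \<in> \<gamma>" using bij that by (rule bij_betw_apply)
    then show ?thesis
      using mem_infinite_maximal_path[OF assms] cyclic_list_path basis_subset_paths by (metis keys_single singletonD subset_eq empty_iff)
  qed
  have "m_element Q I \<gamma> = cls (\<Sum>a\<in>?S. path_elt (gamma_r Q I a))"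
    unfolding m_element_def path_class_eq by (rule cls_sum) (rule path)
  also have "(\<Sum>a\<in>?S. path_elt (gamma_r Q I a) :: _ \<Rightarrow>\<^sub>0 'k) = (\<Sum>c\<in>\<gamma>. path_elt c)"
    by (rule sum.reindex_bij_betw[OF bij])
  finally show ?thesis .
qed

lemma finite_infinite_maximal_path:
  assumes "\<gamma> \<in> infinite_maximal_paths Q I"
  shows "finite \<gamma>"
proof -
  obtain l where l: "cyclic l" "\<gamma> = rotations Q (list_path l)"
    using assms by (auto simp: infinite_maximal_paths_eq)
  have "\<gamma> \<subseteq> (\<lambda>n. list_path (rotate n l)) ` {..<length l}"
  proof
    fix c
    assume "c \<in> \<gamma>"
    then obtain n where "c = list_path (rotate n l)" by (auto simp: l rotations_list_path)
    then have "c = list_path (rotate (n mod length l) l)" by (simp flip: rotate_conv_mod)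
    moreover have "n mod length l < length l" using l by (simp add: cyclic_def)
    ultimately show "c \<in> (\<lambda>n. list_path (rotate n l)) ` {..<length l}" by blast
  qed
  then show ?thesis by (rule finite_subset) simp
qed

end

section \<open>The center\<close>

context gentle_quiver
begin

abbreviation Z :: "(('v, 'e) quiver_path \<Rightarrow>\<^sub>0 'k) set set" where "Z \<equiv> algebra_center A"

section \<open>Coefficients of products with arrows and vertices\<close>

lemma lookup_arrow_mult:
  assumes "Poly_Mapping.keys f \<subseteq> quiver_paths Q" "(v, m) \<in> quiver_paths Q" "m \<noteq> []"
  shows "Poly_Mapping.lookup (path_elt (arrow_path Q a) \<otimes>\<^bsub>P\<^esub> f) (v, m) =
    (if hd m = a then Poly_Mapping.lookup f (head Q a, tl m) else 0)"
  using assms(1)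
proof (induction f rule: poly_mapping_additive_induct)
  case (single p c)
  obtain b m' where m: "m = b # m'" using assms(3) by (cases m) auto
  have v: "v = tail Q b" using assms by (simp add: quiver_paths_iff[OF wf] m)
  show ?case
    by (cases p)
      (auto simp: m v lookup_single when_def path_comp_def arrow_path_def path_source_def path_target_nonempty)
qed (simp_all add: path_algebra_mult_add_right lookup_add)

lemma lookup_mult_arrow:
  assumes "Poly_Mapping.keys f \<subseteq> quiver_paths Q" "(v, m) \<in> quiver_paths Q" "m \<noteq> []"
  shows "Poly_Mapping.lookup (f \<otimes>\<^bsub>P\<^esub> path_elt (arrow_path Q a)) (v, m) =
    (if last m = a then Poly_Mapping.lookup f (v, butlast m) else 0)"
  using assms(1)
proof (induction f rule: poly_mapping_additive_induct)
  case (single p c)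
  obtain b m' where m: "m = m' @ [b]" using assms(3) by (cases m rule: rev_cases) auto
  have "path_target Q (v, m') = tail Q b"
    using assms by (cases "m' = []")
      (auto simp: quiver_paths_iff[OF wf] m successively_append_iff path_target_nonempty)
  then show ?case
    by (cases p) (auto simp: m lookup_single when_def path_comp_def arrow_path_def path_source_def)
qed (simp_all add: path_algebra_mult_add_left lookup_add)

lemma lookup_vertex_mult:
  assumes "Poly_Mapping.keys f \<subseteq> quiver_paths Q"
  shows "Poly_Mapping.lookup (path_elt (v, []) \<otimes>\<^bsub>P\<^esub> f) q =
    (if path_source q = v then Poly_Mapping.lookup f q else 0)"
  using assms
  by (induction f rule: poly_mapping_additive_induct)
    (auto simp: path_algebra_mult_add_right lookup_add lookup_single when_def)

lemma lookup_mult_vertex: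
  assumes "Poly_Mapping.keys f \<subseteq> quiver_paths Q"
  shows "Poly_Mapping.lookup (f \<otimes>\<^bsub>P\<^esub> path_elt (v, [])) q =
    (if path_target Q q = v then Poly_Mapping.lookup f q else 0)"
  using assms
  by (induction f rule: poly_mapping_additive_induct)
    (auto simp: path_algebra_mult_add_left lookup_add lookup_single when_def path_source_def)

lemma keys_mult_paths:
  fixes f g :: "('v, 'e) quiver_path \<Rightarrow>\<^sub>0 'k"
  assumes "Poly_Mapping.keys f \<subseteq> quiver_paths Q" "Poly_Mapping.keys g \<subseteq> quiver_paths Q"
  shows "Poly_Mapping.keys (f \<otimes>\<^bsub>P\<^esub> g) \<subseteq> quiver_paths Q"
  using P.m_closed[of f g] assms by (simp add: path_algebra_simps)

lemma cls_commute_iff: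
  fixes f g :: "('v, 'e) quiver_path \<Rightarrow>\<^sub>0 'k"
  assumes "Poly_Mapping.keys f \<subseteq> quiver_paths Q" "Poly_Mapping.keys g \<subseteq> quiver_paths Q"
  shows "cls f \<otimes>\<^bsub>A\<^esub> cls g = cls g \<otimes>\<^bsub>A\<^esub> cls f \<longleftrightarrow>
    (\<forall>p\<in>B. Poly_Mapping.lookup (f \<otimes>\<^bsub>P\<^esub> g) p = Poly_Mapping.lookup (g \<otimes>\<^bsub>P\<^esub> f) p)"
  using assms by (simp add: cls_mult cls_eq_iff keys_mult_paths)

lemma tl_basis: "(v, m) \<in> B \<Longrightarrow> m \<noteq> [] \<Longrightarrow> (head Q (hd m), tl m) \<in> B"
  using basis_subset_paths
  by (cases m; cases "tl m") (auto simp: basis_iff follows_def)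

lemma butlast_basis: "(v, m) \<in> B \<Longrightarrow> m \<noteq> [] \<Longrightarrow> (v, butlast m) \<in> B"
  by (cases m rule: rev_cases; cases "butlast m = []")
    (auto simp: basis_iff successively_append_iff hd_append)

text \<open>It suffices to commute with the vertices and the arrows, as these generate the algebra.\<close>

lemma center_iff:
  assumes "X \<in> carrier A"
  shows "X \<in> Z \<longleftrightarrow> (\<forall>p\<in>B. nf X p \<noteq> 0 \<longrightarrow> path_source p = path_target Q p) \<and>
    (\<forall>v m. \<forall>a\<in>arcs Q. (v, m) \<in> B \<longrightarrow> m \<noteq> [] \<longrightarrow>
      (if hd m = a then nf X (head Q a, tl m) else 0) = (if last m = a then nf X (v, butlast m) else 0))"
    (is "_ \<longleftrightarrow> ?vert \<and> ?arr")
proof -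
  obtain f where f: "Poly_Mapping.keys f \<subseteq> quiver_paths Q" and X: "X = cls f"
    using assms by (auto simp: A_simps)
  have vertex: "Poly_Mapping.keys (path_elt (v, []) :: _ \<Rightarrow>\<^sub>0 'k) \<subseteq> quiver_paths Q" if "v \<in> verts Q" for v
    using that by (simp add: wf)
  have arrow: "Poly_Mapping.keys (path_elt (arrow_path Q a) :: _ \<Rightarrow>\<^sub>0 'k) \<subseteq> quiver_paths Q" if "a \<in> arcs Q" for a
    using that by (simp add: arrow_path_def quiver_paths_iff[OF wf])
  have vert: "?vert \<longleftrightarrow> (\<forall>v\<in>verts Q. X \<otimes>\<^bsub>A\<^esub> cls (path_elt (v, [])) = cls (path_elt (v, [])) \<otimes>\<^bsub>A\<^esub> X)"
  proof -
    have "(\<forall>v\<in>verts Q. X \<otimes>\<^bsub>A\<^esub> cls (path_elt (v, [])) = cls (path_elt (v, [])) \<otimes>\<^bsub>A\<^esub> X) \<longleftrightarrow>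
      (\<forall>v\<in>verts Q. \<forall>p\<in>B. (if path_target Q p = v then Poly_Mapping.lookup f p else 0) =
        (if path_source p = v then Poly_Mapping.lookup f p else 0))"
      by (simp add: X cls_commute_iff[OF f vertex] lookup_vertex_mult[OF f] lookup_mult_vertex[OF f])
    also have "\<dots> \<longleftrightarrow> (\<forall>p\<in>B. Poly_Mapping.lookup f p \<noteq> 0 \<longrightarrow> path_source p = path_target Q p)"
    proof (intro iffI ballI impI)
      fix p
      assume *: "\<forall>v\<in>verts Q. \<forall>p\<in>B. (if path_target Q p = v then Poly_Mapping.lookup f p else 0) =
        (if path_source p = v then Poly_Mapping.lookup f p else 0)"
        and p: "p \<in> B" "Poly_Mapping.lookup f p \<noteq> 0"
      \<comment> \<open>The vertex to test against is the source of \<open>p\<close>: there one side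
        is the nonzero coefficient, so the other side must not vanish.\<close>
      have "path_source p \<in> verts Q" using p(1) basis_subset_paths path_source_in_verts by blast
      from *[rule_format, OF this p(1)] p(2) show "path_source p = path_target Q p"
        by (metis (full_types))
    next
      fix v p
      assume "\<forall>p\<in>B. Poly_Mapping.lookup f p \<noteq> 0 \<longrightarrow> path_source p = path_target Q p" "p \<in> B"
      then show "(if path_target Q p = v then Poly_Mapping.lookup f p else 0) =
          (if path_source p = v then Poly_Mapping.lookup f p else 0)"
        by (cases "Poly_Mapping.lookup f p = 0") simp_all
    qed
    finally show ?thesis using f by (simp add: X)
  qed
  have arr: "?arr \<longleftrightarrow> (\<forall>a\<in>arcs Q. X \<otimes>\<^bsub>A\<^esub> cls (path_elt (arrow_path Q a)) = cls (path_elt (arrow_path Q a)) \<otimes>\<^bsub>A\<^esub> X)"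
  proof -
    \<comment> \<open>A product with an arrow has no stationary path in its support, so the
      condition is vacuous at empty lists.\<close>
    have empty: "Poly_Mapping.lookup (path_elt (arrow_path Q a) \<otimes>\<^bsub>P\<^esub> f) (v, []) = 0"
      "Poly_Mapping.lookup (f \<otimes>\<^bsub>P\<^esub> path_elt (arrow_path Q a)) (v, []) = 0" for a v
      using keys_path_algebra_mult[of Q "path_elt (arrow_path Q a)" f]
        keys_path_algebra_mult[of Q f "path_elt (arrow_path Q a)"]
      by (auto simp: path_comp_def arrow_path_def in_keys_iff)
    have step: "Poly_Mapping.lookup (f \<otimes>\<^bsub>P\<^esub> path_elt (arrow_path Q a)) (v, m) =
        Poly_Mapping.lookup (path_elt (arrow_path Q a) \<otimes>\<^bsub>P\<^esub> f) (v, m) \<longleftrightarrow>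
        (m \<noteq> [] \<longrightarrow> (if hd m = a then nf X (head Q a, tl m) else 0) =
          (if last m = a then nf X (v, butlast m) else 0))"
      if B: "(v, m) \<in> B" for a v m
    proof (cases "m = []")
      case False
      have "(v, m) \<in> quiver_paths Q" using B basis_subset_paths by blast
      then show ?thesis
        using B False f tl_basis[OF B] butlast_basis[OF B]
        by (auto simp: X lookup_arrow_mult lookup_mult_arrow)
    qed (simp add: empty)
    have "(\<forall>a\<in>arcs Q. X \<otimes>\<^bsub>A\<^esub> cls (path_elt (arrow_path Q a)) = cls (path_elt (arrow_path Q a)) \<otimes>\<^bsub>A\<^esub> X) \<longleftrightarrow>
      (\<forall>a\<in>arcs Q. \<forall>p\<in>B. Poly_Mapping.lookup (f \<otimes>\<^bsub>P\<^esub> path_elt (arrow_path Q a)) p =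
        Poly_Mapping.lookup (path_elt (arrow_path Q a) \<otimes>\<^bsub>P\<^esub> f) p)"
      unfolding X using cls_commute_iff[OF f arrow] by blast
    also have "\<dots> \<longleftrightarrow> (\<forall>v m. \<forall>a\<in>arcs Q. (v, m) \<in> B \<longrightarrow>
        Poly_Mapping.lookup (f \<otimes>\<^bsub>P\<^esub> path_elt (arrow_path Q a)) (v, m) =
        Poly_Mapping.lookup (path_elt (arrow_path Q a) \<otimes>\<^bsub>P\<^esub> f) (v, m))"
      by auto
    also have "\<dots> \<longleftrightarrow> ?arr" by (simp only: step cong: imp_cong)
    finally show ?thesis by blast
  qed
  have generate: "X \<otimes>\<^bsub>A\<^esub> Y = Y \<otimes>\<^bsub>A\<^esub> X"
    if v: "\<And>v. v \<in> verts Q \<Longrightarrow> X \<otimes>\<^bsub>A\<^esub> cls (path_elt (v, [])) = cls (path_elt (v, [])) \<otimes>\<^bsub>A\<^esub> X"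
      and a: "\<And>a. a \<in> arcs Q \<Longrightarrow> X \<otimes>\<^bsub>A\<^esub> cls (path_elt (arrow_path Q a)) = cls (path_elt (arrow_path Q a)) \<otimes>\<^bsub>A\<^esub> X"
      and Y: "Y \<in> carrier A" for Y
  proof -
    have path: "X \<otimes>\<^bsub>A\<^esub> cls (path_elt (w, m)) = cls (path_elt (w, m)) \<otimes>\<^bsub>A\<^esub> X"
      if "(w, m) \<in> quiver_paths Q" for w m
      using that
    proof (induction m arbitrary: w)
      case Nil
      then show ?case using v by (simp add: wf)
    next
      case (Cons b m)
      have b: "b \<in> arcs Q" and w: "w = tail Q b" and m: "(head Q b, m) \<in> quiver_paths Q"
        using Cons.prems by (auto simp: quiver_paths_iff[OF wf] successively_Cons)
      have keys: "Poly_Mapping.keys (path_elt (head Q b, m) :: _ \<Rightarrow>\<^sub>0 'k) \<subseteq> quiver_paths Q"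
        using m by simp
      have "path_elt (w, b # m) = path_elt (arrow_path Q b) \<otimes>\<^bsub>P\<^esub> path_elt (head Q b, m)"
        by (simp add: arrow_path_def path_target_nonempty path_source_def path_comp_def w)
      then have eq: "cls (path_elt (w, b # m)) = cls (path_elt (arrow_path Q b)) \<otimes>\<^bsub>A\<^esub> cls (path_elt (head Q b, m))"
        by (simp add: cls_mult[OF arrow[OF b] keys])
      show ?case
        unfolding eq using a[OF b] Cons.IH[OF m] cls_closed[OF arrow[OF b]] cls_closed[OF keys] assms
        by (metis A.m_assoc)
    qed
    obtain g where g: "Poly_Mapping.keys g \<subseteq> quiver_paths Q" and Y': "Y = cls g"
      using Y by (auto simp: A_simps)
    \<comment> \<open>Phrased as membership of the commutator in the ideal, the claim is additive in
      \<open>g\<close> and reduces to multiples of single paths.\<close>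
    have "f \<otimes>\<^bsub>P\<^esub> g - g \<otimes>\<^bsub>P\<^esub> f \<in> I"
      using g
    proof (induction g rule: poly_mapping_additive_induct)
      case zero
      then show ?case by (simp add: mem_I_iff)
    next
      case (single p c)
      \<comment> \<open>The scalar is pulled out because commutation is known for paths with
        coefficient 1.\<close>
      have mult_scale: "Poly_Mapping.lookup (f \<otimes>\<^bsub>P\<^esub> Poly_Mapping.single p c) q =
            c * Poly_Mapping.lookup (f \<otimes>\<^bsub>P\<^esub> path_elt p) q"
          "Poly_Mapping.lookup (Poly_Mapping.single p c \<otimes>\<^bsub>P\<^esub> f) q =
            c * Poly_Mapping.lookup (path_elt p \<otimes>\<^bsub>P\<^esub> f) q" for q
        by (subst (1 2) path_algebra_mult_eq_sum[of "Poly_Mapping.keys f" "{p}"],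
            simp_all add: lookup_sum sum_distrib_left, intro sum.cong refl, simp add: lookup_single when_def)
          (subst (1 2) path_algebra_mult_eq_sum[of "{p}" "Poly_Mapping.keys f"],
            simp_all add: lookup_sum sum_distrib_left, intro sum.cong refl, simp add: lookup_single when_def)
      have keys: "Poly_Mapping.keys (Poly_Mapping.single p c) \<subseteq> quiver_paths Q"
        "Poly_Mapping.keys (path_elt p :: _ \<Rightarrow>\<^sub>0 'k) \<subseteq> quiver_paths Q"
        using single by simp_all
      have "cls f \<otimes>\<^bsub>A\<^esub> cls (path_elt p) = cls (path_elt p) \<otimes>\<^bsub>A\<^esub> cls f"
        using path[of "fst p" "snd p"] single by (simp add: X)
      then have eq: "\<forall>q\<in>B. Poly_Mapping.lookup (f \<otimes>\<^bsub>P\<^esub> path_elt p) q = Poly_Mapping.lookup (path_elt p \<otimes>\<^bsub>P\<^esub> f) q"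
        by (simp add: cls_commute_iff[OF f keys(2)])
      show ?case
        unfolding mem_I_iff
      proof
        fix q
        assume q: "q \<in> Poly_Mapping.keys (f \<otimes>\<^bsub>P\<^esub> Poly_Mapping.single p c - Poly_Mapping.single p c \<otimes>\<^bsub>P\<^esub> f)"
        then have "q \<in> quiver_paths Q"
          using keys_diff[of "f \<otimes>\<^bsub>P\<^esub> Poly_Mapping.single p c" "Poly_Mapping.single p c \<otimes>\<^bsub>P\<^esub> f"]
            keys_mult_paths[OF f keys(1)] keys_mult_paths[OF keys(1) f] by (meson Un_least subset_iff)
        moreover have "q \<notin> B"
        proof
          assume "q \<in> B"
          then have "Poly_Mapping.lookup (f \<otimes>\<^bsub>P\<^esub> path_elt p) q = Poly_Mapping.lookup (path_elt p \<otimes>\<^bsub>P\<^esub> f) q"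
            using eq by blast
          with q show False by (simp only: in_keys_iff lookup_minus mult_scale) simp
        qed
        ultimately show "q \<in> quiver_paths Q - B" by blast
      qed
    next
      case (add g h)
      have "(f \<otimes>\<^bsub>P\<^esub> g - g \<otimes>\<^bsub>P\<^esub> f) \<oplus>\<^bsub>P\<^esub> (f \<otimes>\<^bsub>P\<^esub> h - h \<otimes>\<^bsub>P\<^esub> f) \<in> I"
        by (rule I.a_closed) (fact add)+
      then show ?case
        by (simp add: path_algebra_simps path_algebra_mult_add_left path_algebra_mult_add_right algebra_simps)
    qed
    then show ?thesis
      unfolding X Y' cls_commute_iff[OF f g] mem_I_iff by (auto simp: in_keys_iff lookup_minus subset_iff)
  qed
  show ?thesis
    unfolding vert arr
  proof
    assume "X \<in> Z"
    then show "(\<forall>v\<in>verts Q. X \<otimes>\<^bsub>A\<^esub> cls (path_elt (v, [])) = cls (path_elt (v, [])) \<otimes>\<^bsub>A\<^esub> X) \<and>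
        (\<forall>a\<in>arcs Q. X \<otimes>\<^bsub>A\<^esub> cls (path_elt (arrow_path Q a)) = cls (path_elt (arrow_path Q a)) \<otimes>\<^bsub>A\<^esub> X)"
      using cls_closed[OF vertex] cls_closed[OF arrow] by (simp add: algebra_center_def)
  next
    assume "(\<forall>v\<in>verts Q. X \<otimes>\<^bsub>A\<^esub> cls (path_elt (v, [])) = cls (path_elt (v, [])) \<otimes>\<^bsub>A\<^esub> X) \<and>
        (\<forall>a\<in>arcs Q. X \<otimes>\<^bsub>A\<^esub> cls (path_elt (arrow_path Q a)) = cls (path_elt (arrow_path Q a)) \<otimes>\<^bsub>A\<^esub> X)"
    then show "X \<in> Z" using generate assms by (simp add: algebra_center_def)
  qed
qed

section \<open>The center as a subalgebra\<close>

lemma center_subring: "subring Z A"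
proof (rule A.subringI)
  show "\<ominus>\<^bsub>A\<^esub> x \<in> Z" if "x \<in> Z" for x
    using that by (simp add: algebra_center_def A.l_minus A.r_minus)
  show "x \<otimes>\<^bsub>A\<^esub> y \<in> Z" if "x \<in> Z" "y \<in> Z" for x y
  proof -
    have *: "x \<in> carrier A" "y \<in> carrier A" "\<And>w. w \<in> carrier A \<Longrightarrow> x \<otimes>\<^bsub>A\<^esub> w = w \<otimes>\<^bsub>A\<^esub> x"
      "\<And>w. w \<in> carrier A \<Longrightarrow> y \<otimes>\<^bsub>A\<^esub> w = w \<otimes>\<^bsub>A\<^esub> y"
      using that by (auto simp: algebra_center_def)
    have "x \<otimes>\<^bsub>A\<^esub> y \<otimes>\<^bsub>A\<^esub> w = w \<otimes>\<^bsub>A\<^esub> (x \<otimes>\<^bsub>A\<^esub> y)" if w: "w \<in> carrier A" for w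
    proof -
      have "x \<otimes>\<^bsub>A\<^esub> y \<otimes>\<^bsub>A\<^esub> w = x \<otimes>\<^bsub>A\<^esub> (w \<otimes>\<^bsub>A\<^esub> y)"
        unfolding *(4)[OF w, symmetric] by (rule A.m_assoc[OF *(1,2) w])
      also have "\<dots> = x \<otimes>\<^bsub>A\<^esub> w \<otimes>\<^bsub>A\<^esub> y" by (rule A.m_assoc[OF *(1) w *(2), symmetric])
      also have "\<dots> = w \<otimes>\<^bsub>A\<^esub> (x \<otimes>\<^bsub>A\<^esub> y)" unfolding *(3)[OF w] by (rule A.m_assoc[OF w *(1,2)])
      finally show ?thesis .
    qed
    then show ?thesis unfolding algebra_center_def using A.m_closed[OF *(1,2)] by blast
  qed
qed (auto simp: algebra_center_def A.l_distr A.r_distr)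

lemma center_closed: "X \<in> Z \<Longrightarrow> X \<in> carrier A"
  by (simp add: algebra_center_def)

lemma center_smult:
  assumes "X \<in> Z"
  shows "c \<odot>\<^bsub>A\<^esub> X \<in> Z"
proof -
  have X: "X \<in> carrier A" using assms by (rule center_closed)
  show ?thesis
    unfolding center_iff[OF smult_closed[OF X]]
  proof (intro conjI ballI allI impI)
    fix p
    assume "p \<in> B" "nf (c \<odot>\<^bsub>A\<^esub> X) p \<noteq> 0"
    then show "path_source p = path_target Q p"
      using assms X by (simp add: center_iff nf_smult)
  next
    fix v m a
    assume m: "a \<in> arcs Q" "(v, m) \<in> B" "m \<noteq> []"
    have "(if hd m = a then nf X (head Q a, tl m) else 0) = (if last m = a then nf X (v, butlast m) else 0)"
      using assms m unfolding center_iff[OF X] by blast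
    then show "(if hd m = a then nf (c \<odot>\<^bsub>A\<^esub> X) (head Q a, tl m) else 0) =
        (if last m = a then nf (c \<odot>\<^bsub>A\<^esub> X) (v, butlast m) else 0)"
      using X tl_basis[OF m(2,3)] butlast_basis[OF m(2,3)] by (auto simp: nf_smult split: if_splits)
  qed
qed

end

section \<open>A basis of the center\<close>

text \<open>The word identity that relates a power of a cycle to the same power of its rotation by
  one arrow.\<close>

lemma concat_replicate_snoc:
  "concat (replicate n (x # xs)) @ [x] = x # concat (replicate n (xs @ [x]))"
  by (induction n) simp_all

section \<open>Supports of the family and powers of its infinite members\<close>

context gentle_quiver
begin

text \<open>The paths at which the indexed element has coefficient 1; at all other paths of
  \<open>B\<close> its coefficient is 0.\<close>

fun index_paths :: "('v, 'e) center_index \<Rightarrow> ('v, 'e) quiver_path set" where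
  "index_paths Identity = (\<lambda>v. (v, [])) ` verts Q"
| "index_paths (Maximal_Cycle p) = {p}"
| "index_paths (M_Power \<gamma> n) = (\<lambda>c. path_power c n) ` \<gamma>"

lemma path_power_list_path:
  assumes "cyclic l" "n > 0"
  shows "path_power (list_path l) n = list_path (concat (replicate n l))"
  using cyclic_concat_replicate(2)[OF assms] by (simp add: path_power_def list_path_def)

lemma path_power_in_basis:
  assumes "\<gamma> \<in> infinite_maximal_paths Q I" "c \<in> \<gamma>" "n > 0"
  shows "path_power c n \<in> B"
  using mem_infinite_maximal_path[OF assms(1,2)] path_power_list_path[OF _ assms(3)]
    cyclic_list_path cyclic_concat_replicate(1)[OF _ assms(3)] by metis

text \<open>Both powers begin with the first arrow of their roots, which determines a
  repetition-free cycle; comparing lengths then gives the exponent.\<close>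

lemma path_power_eqD:
  assumes "cyclic l" "distinct l" "n > 0" "cyclic l'" "distinct l'" "n' > 0"
    and "path_power (list_path l) n = path_power (list_path l') n'"
  shows "l = l' \<and> n = n'"
proof -
  have eq: "concat (replicate n l) = concat (replicate n' l')"
    using assms(7) path_power_list_path[OF assms(1,3)] path_power_list_path[OF assms(4,6)] by simp
  have "l = l'"
    using assms arg_cong[OF eq, of hd] by (intro cyclic_distinct_eq) (simp_all add: cyclic_concat_replicate)
  moreover have "length (concat (replicate k l)) = k * length l" for k
    by (induction k) simp_all
  then have "n * length l = n' * length l" using eq \<open>l = l'\<close> by metis
  then have "n = n'" using assms(1) by (simp add: cyclic_def)
  ultimately show ?thesis ..
qed

lemma inj_on_path_power:
  assumes "\<gamma> \<in> infinite_maximal_paths Q I" "n > 0"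
  shows "inj_on (\<lambda>c. path_power c n) \<gamma>"
proof (rule inj_onI)
  fix c d
  assume "c \<in> \<gamma>" "d \<in> \<gamma>" and eq: "path_power c n = path_power d n"
  obtain l where "c = list_path l" "cyclic l" "distinct l"
    using mem_infinite_maximal_path[OF assms(1) \<open>c \<in> \<gamma>\<close>] .
  moreover obtain l' where "d = list_path l'" "cyclic l'" "distinct l'"
    using mem_infinite_maximal_path[OF assms(1) \<open>d \<in> \<gamma>\<close>] .
  ultimately show "c = d" using path_power_eqD[of l n l' n] eq assms(2) by simp
qed

text \<open>Products of distinct rotations vanish because an arrow has at most one successor.\<close>

lemma lookup_path_power_mult:
  assumes \<gamma>: "\<gamma> \<in> infinite_maximal_paths Q I" and cd: "c \<in> \<gamma>" "d \<in> \<gamma>" and n: "n > 0" and p: "p \<in> B"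
  shows "Poly_Mapping.lookup (path_elt (path_power c n) \<otimes>\<^bsub>P\<^esub> path_elt d) p =
    (if d = c then Poly_Mapping.lookup (path_elt (path_power c (Suc n)) :: _ \<Rightarrow>\<^sub>0 'k) p else 0)"
proof -
  obtain l where l: "c = list_path l" "cyclic l" "distinct l"
    using mem_infinite_maximal_path[OF \<gamma> cd(1)] .
  obtain l' where l': "d = list_path l'" "cyclic l'" "distinct l'"
    using mem_infinite_maximal_path[OF \<gamma> cd(2)] .
  let ?w = "concat (replicate n l)"
  note w = cyclic_concat_replicate[OF l(2) n]
  have w_ne: "?w \<noteq> []" using w(1) by (simp add: cyclic_def)
  have cn: "path_power c n = list_path ?w" using l n by (simp add: path_power_list_path)
  show ?thesis
  proof (cases "d = c")
    case True
    have "head Q (last l) = tail Q (hd l)" using l by (simp add: cyclic_def follows_def)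
    then have "path_target Q (list_path ?w) = path_source (list_path l)"
      using w w_ne unfolding list_path_def by (simp add: path_target_nonempty path_source_def)
    moreover have "replicate n l @ [l] = replicate (Suc n) l" by (simp add: replicate_append_same)
    then have "?w @ l = concat (replicate (Suc n) l)" by (metis concat.simps concat_append append_Nil2)
    then have "path_comp (list_path ?w) (list_path l) = path_power c (Suc n)"
      using w(2) l by (simp add: path_comp_def path_power_def list_path_def)
    ultimately show ?thesis unfolding cn True by (simp add: l)
  next
    case False
    \<comment> \<open>If the factors do not compose, the product is already 0; otherwise it is the
      element of their composition, which cannot be a path of \<open>B\<close>.\<close>
    have "path_comp (list_path ?w) (list_path l') \<noteq> p"
    proof
      assume "path_comp (list_path ?w) (list_path l') = p"
      then have "snd p = ?w @ l'" by (auto simp: path_comp_def)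
      then have "follows (last l) (hd l')"
        using basis_successively[OF p] w w_ne l' by (simp add: successively_append_iff cyclic_def)
      then have "hd l' = hd l" using l follows_right_unique by (auto simp: cyclic_def)
      then show False using False l l' cyclic_distinct_eq by metis
    qed
    then show ?thesis using False unfolding cn by (simp add: l' lookup_single)
  qed
qed

text \<open>In the expanded product only the diagonal terms survive. The exponent must be positive:
  the zeroth power is the identity, not a sum of stationary paths along the cycle.\<close>

lemma m_element_power:
  assumes \<gamma>: "\<gamma> \<in> infinite_maximal_paths Q I" and "n > 0"
  shows "m_element Q I \<gamma> [^]\<^bsub>A\<^esub> n = cls (\<Sum>c\<in>\<gamma>. path_elt (path_power c n))"
  using assms(2)
proof (induction n rule: nat_induct_non_zero)
  case 1
  have keys: "Poly_Mapping.keys (\<Sum>c\<in>\<gamma>. path_elt c :: _ \<Rightarrow>\<^sub>0 'k) \<subseteq> quiver_paths Q"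
  proof (rule keys_sum_subset)
    fix c
    assume "c \<in> \<gamma>"
    then have "path_power c 1 \<in> B" using path_power_in_basis[OF \<gamma>] by simp
    then show "Poly_Mapping.keys (path_elt c :: _ \<Rightarrow>\<^sub>0 'k) \<subseteq> quiver_paths Q"
      using basis_subset_paths by (auto simp: path_power_def)
  qed
  show ?case
    using cls_closed[OF keys] by (simp add: m_element_eq[OF \<gamma>] path_power_def)
next
  case (Suc n)
  have keys: "Poly_Mapping.keys (\<Sum>c\<in>\<gamma>. path_elt (path_power c k) :: _ \<Rightarrow>\<^sub>0 'k) \<subseteq> quiver_paths Q" if "k > 0" for k
    by (rule keys_sum_subset) (use path_power_in_basis[OF \<gamma> _ that] basis_subset_paths in auto)
  have keys1: "Poly_Mapping.keys (\<Sum>c\<in>\<gamma>. path_elt c :: _ \<Rightarrow>\<^sub>0 'k) \<subseteq> quiver_paths Q"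
    using keys[of 1] by (simp add: path_power_def)
  let ?F = "(\<Sum>c\<in>\<gamma>. path_elt (path_power c n)) \<otimes>\<^bsub>P\<^esub> (\<Sum>c\<in>\<gamma>. path_elt c) :: _ \<Rightarrow>\<^sub>0 'k"
  have "m_element Q I \<gamma> [^]\<^bsub>A\<^esub> Suc n = cls (\<Sum>c\<in>\<gamma>. path_elt (path_power c n)) \<otimes>\<^bsub>A\<^esub> cls (\<Sum>c\<in>\<gamma>. path_elt c)"
    using Suc.IH m_element_eq[OF \<gamma>] by simp
  also have "\<dots> = cls ?F" by (rule cls_mult[OF keys[OF Suc.hyps] keys1])
  \<comment> \<open>Products of different rotations that compose vanish only modulo the ideal, so
    the two sums are compared at \<open>B\<close> and not in the path algebra.\<close>
  also have "\<dots> = cls (\<Sum>c\<in>\<gamma>. path_elt (path_power c (Suc n)))"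
    unfolding cls_eq_iff[OF keys_mult_paths[OF keys[OF Suc.hyps] keys1] keys[OF zero_less_Suc]]
  proof
    fix p
    assume p: "p \<in> B"
    have "Poly_Mapping.lookup ?F p =
        (\<Sum>c\<in>\<gamma>. \<Sum>d\<in>\<gamma>. Poly_Mapping.lookup (path_elt (path_power c n) \<otimes>\<^bsub>P\<^esub> path_elt d) p)"
      by (simp only: path_algebra_mult_sum_left lookup_sum)
        (simp only: path_algebra_mult_sum_right lookup_sum)
    also have "\<dots> = (\<Sum>c\<in>\<gamma>. \<Sum>d\<in>\<gamma>. if d = c then Poly_Mapping.lookup (path_elt (path_power c (Suc n)) :: _ \<Rightarrow>\<^sub>0 'k) p else 0)"
      by (intro sum.cong refl lookup_path_power_mult[OF \<gamma> _ _ Suc.hyps p])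
    also have "\<dots> = Poly_Mapping.lookup (\<Sum>c\<in>\<gamma>. path_elt (path_power c (Suc n))) p"
      by (simp add: finite_infinite_maximal_path[OF \<gamma>] lookup_sum)
    finally show "Poly_Mapping.lookup ?F p = Poly_Mapping.lookup (\<Sum>c\<in>\<gamma>. path_elt (path_power c (Suc n))) p" .
  qed
  finally show ?case .
qed

lemma index_paths_props:
  assumes "i \<in> center_indices Q I"
  shows "finite (index_paths i)" "index_paths i \<noteq> {}" "index_paths i \<subseteq> B"
    and "center_family Q I i = cls (\<Sum>p\<in>index_paths i. path_elt p)"
proof -
  consider "i = Identity" | p where "i = Maximal_Cycle p" "p \<in> finite_maximal_cycles Q I"
    | \<gamma> n where "i = M_Power \<gamma> n" "\<gamma> \<in> infinite_maximal_paths Q I" "n > 0"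
    using assms by (auto simp: center_indices_def)
  then have "finite (index_paths i) \<and> index_paths i \<noteq> {} \<and> index_paths i \<subseteq> B \<and>
    center_family Q I i = cls (\<Sum>p\<in>index_paths i. path_elt p)"
  proof cases
    case 1
    have "verts Q \<noteq> {}" using quiver by (simp add: quiver_def)
    moreover have "(\<Sum>p\<in>(\<lambda>v. (v, [])) ` verts Q. path_elt p :: _ \<Rightarrow>\<^sub>0 'k) = \<one>\<^bsub>P\<^esub>"
      by (subst sum.reindex) (auto simp: path_algebra_simps inj_on_def)
    ultimately show ?thesis using 1 by (auto simp: A_simps)
  next
    case 2
    then show ?thesis
      by (simp add: path_class_eq finite_maximal_cycles_def finite_maximal_paths_def)
  next
    case 3
    have "(\<Sum>p\<in>(\<lambda>c. path_power c n) ` \<gamma>. path_elt p :: _ \<Rightarrow>\<^sub>0 'k) = (\<Sum>c\<in>\<gamma>. path_elt (path_power c n))"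
      by (simp add: sum.reindex[OF inj_on_path_power[OF 3(2,3)]])
    then show ?thesis
      using 3 path_power_in_basis[OF 3(2) _ 3(3)]
      by (auto simp: finite_infinite_maximal_path infinite_maximal_path_nonempty m_element_power)
  qed
  then show "finite (index_paths i)" "index_paths i \<noteq> {}" "index_paths i \<subseteq> B"
    "center_family Q I i = cls (\<Sum>p\<in>index_paths i. path_elt p)" by blast+
qed

lemma keys_index_sum:
  "i \<in> center_indices Q I \<Longrightarrow>
    Poly_Mapping.keys (\<Sum>p\<in>index_paths i. path_elt p :: _ \<Rightarrow>\<^sub>0 'k) \<subseteq> quiver_paths Q"
  by (rule keys_sum_subset) (use index_paths_props(3) basis_subset_paths in auto)

lemma center_family_closed: "i \<in> center_indices Q I \<Longrightarrow> center_family Q I i \<in> carrier A"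
  using cls_closed[OF keys_index_sum] by (simp add: index_paths_props(4))

lemma nf_center_family:
  assumes "i \<in> center_indices Q I" "p \<in> B"
  shows "nf (center_family Q I i) p = (if p \<in> index_paths i then 1 else 0)"
  using assms index_paths_props(1)[OF assms(1)]
  by (simp add: index_paths_props(4) keys_index_sum lookup_sum lookup_single when_def)

lemma index_paths_M_PowerE:
  assumes "p \<in> index_paths (M_Power \<gamma> n)" "M_Power \<gamma> n \<in> center_indices Q I"
  obtains l where "p = path_power (list_path l) n" "list_path l \<in> \<gamma>" "cyclic l" "distinct l" "n > 0"
    "\<gamma> = rotations Q (list_path l)" "cyclic (snd p)"
proof -
  have n: "n > 0" and \<gamma>: "\<gamma> \<in> infinite_maximal_paths Q I"
    using assms(2) by (auto simp: center_indices_def)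
  obtain c where c: "c \<in> \<gamma>" "p = path_power c n" using assms(1) by auto
  obtain l where l: "c = list_path l" "cyclic l" "distinct l" "\<gamma> = rotations Q (list_path l)"
    using mem_infinite_maximal_path[OF \<gamma> c(1)] .
  show thesis
    by (rule that[of l]) (use c l n in \<open>simp_all add: path_power_list_path cyclic_concat_replicate\<close>)
qed

lemma finite_maximal_not_cyclic:
  assumes "p \<in> finite_maximal_paths Q I"
  shows "\<not> cyclic (snd p)"
proof
  assume c: "cyclic (snd p)"
  then have "hd (snd p) \<in> set (snd p)" by (simp add: cyclic_def)
  then show False using cyclic_not_finite_maximal[OF c _ assms] by blast
qed

text \<open>The kind of index can be read off from the arrows of \<open>p\<close>: none for the
  identity, a cyclic list for a power, a nonempty list that is not cyclic for a finite maximal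
  cycle. Within the powers, \<open>path_power_eqD\<close> recovers class and exponent.\<close>

lemma index_paths_disjoint:
  assumes i: "i \<in> center_indices Q I" "p \<in> index_paths i" and j: "j \<in> center_indices Q I" "p \<in> index_paths j"
  shows "i = j"
proof -
  have nil: "snd p = [] \<longleftrightarrow> k = Identity" "cyclic (snd p) \<longleftrightarrow> (\<exists>\<gamma> n. k = M_Power \<gamma> n)"
    if k: "k \<in> center_indices Q I" "p \<in> index_paths k" for k
  proof -
    have "(snd p = [] \<longleftrightarrow> k = Identity) \<and> (cyclic (snd p) \<longleftrightarrow> (\<exists>\<gamma> n. k = M_Power \<gamma> n))"
    proof (cases k)
      case Identity
      then show ?thesis using k by (auto simp: cyclic_def)
    next
      case (Maximal_Cycle q)
      then have "p \<in> finite_maximal_paths Q I" "snd p \<noteq> []"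
        using k by (auto simp: center_indices_def finite_maximal_cycles_def quiver_cycle_def)
      then show ?thesis using Maximal_Cycle finite_maximal_not_cyclic by simp
    next
      case (M_Power \<gamma> n)
      then have "cyclic (snd p)" using k index_paths_M_PowerE by metis
      then show ?thesis using M_Power by (simp add: cyclic_def)
    qed
    then show "snd p = [] \<longleftrightarrow> k = Identity" "cyclic (snd p) \<longleftrightarrow> (\<exists>\<gamma> n. k = M_Power \<gamma> n)" by blast+
  qed
  show ?thesis
  proof (cases i)
    case Identity
    then show ?thesis using nil[OF i] nil[OF j] by simp
  next
    case (Maximal_Cycle q)
    then obtain q' where "j = Maximal_Cycle q'"
      using nil[OF i] nil[OF j] by (cases j) simp_all
    then show ?thesis using Maximal_Cycle i j by simp
  next
    case (M_Power \<gamma> n)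
    then obtain \<gamma>' n' where j': "j = M_Power \<gamma>' n'"
      using nil[OF i] nil[OF j] by (cases j) simp_all
    obtain l where l: "p = path_power (list_path l) n" "cyclic l" "distinct l" "n > 0"
      "\<gamma> = rotations Q (list_path l)"
      using i unfolding M_Power by (elim index_paths_M_PowerE)
    obtain l' where l': "p = path_power (list_path l') n'" "cyclic l'" "distinct l'" "n' > 0"
      "\<gamma>' = rotations Q (list_path l')"
      using j unfolding j' by (elim index_paths_M_PowerE)
    show ?thesis using path_power_eqD[of l n l' n'] l l' by (simp add: M_Power j')
  qed
qed

lemma inj_on_center_family: "inj_on (center_family Q I) (center_indices Q I)"
proof (rule inj_onI)
  fix i j
  assume i: "i \<in> center_indices Q I" and j: "j \<in> center_indices Q I"
    and eq: "center_family Q I i = center_family Q I j"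
  obtain p where p: "p \<in> index_paths i" "p \<in> B" using index_paths_props(2,3)[OF i] by blast
  then have "nf (center_family Q I j) p = 1" using nf_center_family[OF i] eq by simp
  then have "p \<in> index_paths j" using nf_center_family[OF j p(2)] by (simp split: if_splits)
  then show "i = j" using index_paths_disjoint i j p by blast
qed

section \<open>Centrality of the family\<close>

lemma finite_maximal_cycle_central:
  assumes "p \<in> finite_maximal_cycles Q I"
  shows "path_class Q I p \<in> Z"
proof -
  have p: "p \<in> finite_maximal_paths Q I" "snd p \<noteq> []" "path_source p = path_target Q p"
    using assms by (auto simp: finite_maximal_cycles_def quiver_cycle_def)
  have B: "p \<in> B" using p by (simp add: finite_maximal_paths_def)
  have keys: "Poly_Mapping.keys (path_elt p :: _ \<Rightarrow>\<^sub>0 'k) \<subseteq> quiver_paths Q"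
    using B basis_subset_paths by auto
  have max: "\<not> follows (last (snd p)) a" "\<not> follows a (hd (snd p))" for a
    using p finite_maximal_path_iff[of "snd p" "fst p"] by simp_all
  have nf: "nf (cls (path_elt p)) q = (if q = p then 1 else 0)" if "q \<in> B" for q
    using that keys by (simp add: lookup_single when_def)
  show ?thesis
    unfolding path_class_eq center_iff[OF cls_closed[OF keys]]
  proof (intro conjI ballI allI impI)
    fix q
    assume "q \<in> B" "nf (cls (path_elt p)) q \<noteq> 0"
    then show "path_source q = path_target Q q" using nf p by (simp split: if_splits)
  next
    fix v m a
    assume m: "a \<in> arcs Q" "(v, m) \<in> B" "m \<noteq> []"
    have "successively follows m" using basis_successively[OF m(2)] by simp
    \<comment> \<open>No path of \<open>B\<close> prolongs \<open>p\<close> by an arrow on either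
      side, so both sides of the centrality criterion are 0.\<close>
    then have "(head Q (hd m), tl m) \<noteq> p" "(v, butlast m) \<noteq> p"
    proof -
      assume s: "successively follows m"
      show "(head Q (hd m), tl m) \<noteq> p"
      proof
        assume "(head Q (hd m), tl m) = p"
        then have "tl m = snd p" by auto
        then show False using s p(2) max(2) m(3) by (cases m) (auto simp: successively_Cons)
      qed
      show "(v, butlast m) \<noteq> p"
      proof
        assume "(v, butlast m) = p"
        then have "butlast m = snd p" by auto
        then show False using s p(2) max(1) m(3)
          by (cases m rule: rev_cases) (auto simp: successively_append_iff)
      qed
    qed
    then show "(if hd m = a then nf (cls (path_elt p)) (head Q a, tl m) else 0) =
        (if last m = a then nf (cls (path_elt p)) (v, butlast m) else 0)"
      using nf[OF tl_basis[OF m(2,3)]] nf[OF butlast_basis[OF m(2,3)]] by auto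
  qed
qed

text \<open>Prolonging a cycle by an arrow on one side gives the same path as prolonging one of its
  rotations on the other side, so cutting off either end lands in the same rotation class.\<close>

lemma m_element_central:
  assumes \<gamma>: "\<gamma> \<in> infinite_maximal_paths Q I"
  shows "m_element Q I \<gamma> \<in> Z"
proof -
  have inB: "\<gamma> \<subseteq> B" using path_power_in_basis[OF \<gamma>, of _ 1] by (auto simp: path_power_def)
  have keys: "Poly_Mapping.keys (\<Sum>c\<in>\<gamma>. path_elt c :: _ \<Rightarrow>\<^sub>0 'k) \<subseteq> quiver_paths Q"
    by (rule keys_sum_subset) (use inB basis_subset_paths in auto)
  have nf: "nf (cls (\<Sum>c\<in>\<gamma>. path_elt c)) q = (if q \<in> \<gamma> then 1 else 0)" if "q \<in> B" for q
    using that keys finite_infinite_maximal_path[OF \<gamma>]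
    by (simp add: lookup_sum lookup_single when_def)
  show ?thesis
    unfolding m_element_eq[OF \<gamma>] center_iff[OF cls_closed[OF keys]]
  proof (intro conjI ballI allI impI)
    fix q
    assume "q \<in> B" "nf (cls (\<Sum>c\<in>\<gamma>. path_elt c)) q \<noteq> 0"
    then have "q \<in> \<gamma>" using nf by (simp split: if_splits)
    then obtain l where "q = list_path l" "cyclic l" using mem_infinite_maximal_path[OF \<gamma>] by metis
    then have "quiver_cycle Q q" using cyclic_quiver_cycle by simp
    then show "path_source q = path_target Q q" by (simp add: quiver_cycle_def)
  next
    fix v m a
    assume m: "a \<in> arcs Q" "(v, m) \<in> B" "m \<noteq> []"
    have s: "successively follows m" using basis_successively[OF m(2)] by simp
    have "hd m = a \<and> (head Q a, tl m) \<in> \<gamma> \<longleftrightarrow> last m = a \<and> (v, butlast m) \<in> \<gamma>"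
    proof
      assume *: "hd m = a \<and> (head Q a, tl m) \<in> \<gamma>"
      obtain u where u: "(head Q a, tl m) = list_path u" "cyclic u"
        using mem_infinite_maximal_path[OF \<gamma>, of "(head Q a, tl m)"] * by metis
      then have mu: "m = a # u" using * m(3) by (cases m) (auto simp: list_path_def)
      \<comment> \<open>The predecessor of the first arrow of a cycle is its last arrow. So
        \<open>a # butlast u\<close> is the rotation of \<open>u\<close> that remains when the last
        arrow of \<open>m\<close> is removed.\<close>
      have "follows a (hd u)" using s u(2) by (cases u) (auto simp: mu cyclic_def)
      then have a: "a = last u" using cyclic_predecessor[OF u(2)] by simp
      have ne: "u \<noteq> []" using u(2) by (simp add: cyclic_def)
      have "rotate1 (a # butlast u) = u" using ne a by simp
      then have "list_path (a # butlast u) \<in> \<gamma>"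
        using infinite_maximal_path_rotate1[OF \<gamma>, of "a # butlast u"] * u(1) by simp
      moreover have "(v, butlast m) = list_path (a # butlast u)"
        using m(2) ne by (simp add: mu list_path_def basis_iff)
      ultimately show "last m = a \<and> (v, butlast m) \<in> \<gamma>" using a ne by (simp add: mu)
    next
      assume *: "last m = a \<and> (v, butlast m) \<in> \<gamma>"
      obtain u where u: "(v, butlast m) = list_path u" "cyclic u"
        using mem_infinite_maximal_path[OF \<gamma>, of "(v, butlast m)"] * by metis
      then have mu: "m = u @ [a]" using * m(3) by (cases m rule: rev_cases) (auto simp: list_path_def)
      have ne: "u \<noteq> []" using u(2) by (simp add: cyclic_def)
      have "follows (last u) a" using s ne by (simp add: mu successively_append_iff)
      then have a: "a = hd u" using u(2) follows_right_unique by (auto simp: cyclic_def)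
      have rot: "rotate1 u = tl m" using ne a by (cases u) (simp_all add: mu)
      then have "list_path (tl m) \<in> \<gamma>"
        using infinite_maximal_path_rotate1[OF \<gamma>, of u] * u(1) by simp
      moreover have "tl m \<noteq> []" using ne by (simp add: mu)
      then have "(head Q (hd m), tl m) = list_path (tl m)"
        using basis_list_path[OF tl_basis[OF m(2,3)]] by simp
      moreover have "hd m = a" using a ne by (simp add: mu)
      ultimately show "hd m = a \<and> (head Q a, tl m) \<in> \<gamma>" by simp
    qed
    then show "(if hd m = a then nf (cls (\<Sum>c\<in>\<gamma>. path_elt c)) (head Q a, tl m) else 0) =
        (if last m = a then nf (cls (\<Sum>c\<in>\<gamma>. path_elt c)) (v, butlast m) else 0)"
      using nf[OF tl_basis[OF m(2,3)]] nf[OF butlast_basis[OF m(2,3)]] by auto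
  qed
qed

lemma subring_nat_pow:
  assumes "subring S A" "x \<in> S"
  shows "x [^]\<^bsub>A\<^esub> (n::nat) \<in> S"
  by (induction n) (simp_all add: subringE(3,6)[OF assms(1)] assms(2))

text \<open>Stated for an arbitrary subring to serve twice: for the center it gives centrality of
  the powers, for a subalgebra containing the generators it gives generation.\<close>

lemma center_family_in_subring:
  assumes "subring S A" "path_class Q I ` finite_maximal_cycles Q I \<subseteq> S"
    "m_element Q I ` infinite_maximal_paths Q I \<subseteq> S" "i \<in> center_indices Q I"
  shows "center_family Q I i \<in> S"
  using assms subringE(3)[OF assms(1)] subring_nat_pow[OF assms(1)] by (auto simp: center_indices_def)

lemma center_family_central: "i \<in> center_indices Q I \<Longrightarrow> center_family Q I i \<in> Z"
  by (rule center_family_in_subring[OF center_subring])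
    (auto simp: finite_maximal_cycle_central m_element_central)

section \<open>The shape of central elements\<close>

lemma center_support:
  assumes X: "X \<in> Z" and p: "p \<in> B" "nf X p \<noteq> 0"
  shows "\<exists>i\<in>center_indices Q I. p \<in> index_paths i"
proof -
  have XA: "X \<in> carrier A" using X by (rule center_closed)
  obtain v m where vm: "p = (v, m)" by force
  have closed: "path_source p = path_target Q p" using X p center_iff[OF XA] by blast
  have arr: "(if hd w = a then nf X (head Q a, tl w) else 0) = (if last w = a then nf X (u, butlast w) else 0)"
    if "a \<in> arcs Q" "(u, w) \<in> B" "w \<noteq> []" for u w a
    using X that center_iff[OF XA] by blast
  show ?thesis
  proof (cases "m = []")
    case True
    then have "p \<in> index_paths Identity" using p by (simp add: vm)
    then show ?thesis by (intro bexI[of _ Identity]) (auto simp: center_indices_def)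
  next
    case False
    have m: "v = tail Q (hd m)" "set m \<subseteq> arcs Q" "successively follows m"
      using p(1) False by (simp_all add: vm basis_iff)
    show ?thesis
    proof (cases "p \<in> finite_maximal_paths Q I")
      case True
      then have "p \<in> finite_maximal_cycles Q I"
        using closed False p(1) basis_subset_paths
        by (auto simp: finite_maximal_cycles_def quiver_cycle_def vm)
      then show ?thesis by (intro bexI[of _ "Maximal_Cycle p"]) (auto simp: center_indices_def)
    next
      case notmax: False
      have "cyclic m"
      proof (cases "\<exists>a. follows (last m) a")
        case True
        then obtain a where a: "follows (last m) a" ..
        \<comment> \<open>At this path the right side of the criterion is the nonzero coefficient at
          \<open>p\<close>; the left side can be nonzero only if the path also begins with
          \<open>a\<close>, so the successor of the last arrow of \<open>m\<close> is its first
          arrow.\<close>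
        have "(v, m @ [a]) \<in> B"
          using m False a by (simp add: basis_iff successively_append_iff follows_arcs)
        from arr[OF _ this, of a] have "hd m = a"
          using p(2) False follows_arcs[OF a] by (auto simp: vm split: if_splits)
        then show ?thesis using a m False by (simp add: cyclic_def)
      next
        case no_succ: False
        then obtain a where a: "follows a (hd m)"
          using notmax p(1) False by (auto simp: vm finite_maximal_path_iff)
        \<comment> \<open>The same comparison from the left: the path must also end in
          \<open>a\<close>, so the predecessor of the first arrow is the last one.\<close>
        have "(tail Q a, a # m) \<in> B"
          using m False a by (simp add: basis_iff successively_Cons follows_arcs)
        from arr[OF _ this, of a] have "nf X (head Q a, m) = 0 \<or> last m = a"
          using False follows_arcs[OF a] by (auto split: if_splits)
        moreover have "head Q a = v" using a m by (simp add: follows_def)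
        ultimately have "last m = a" using p(2) by (simp add: vm)
        then show ?thesis using a m False by (simp add: cyclic_def)
      qed
      then obtain u n where u: "cyclic u" "distinct u" "n > 0" "m = concat (replicate n u)"
        by (rule cyclic_power)
      let ?\<gamma> = "rotations Q (list_path u)"
      have "?\<gamma> \<in> infinite_maximal_paths Q I" using u by (auto simp: infinite_maximal_paths_eq)
      moreover have "list_path u \<in> ?\<gamma>"
        unfolding rotations_list_path by (rule range_eqI[of _ _ 0]) simp
      moreover have "p = list_path m" by (simp add: vm m(1) list_path_def)
      then have "p = path_power (list_path u) n" using path_power_list_path[OF u(1,3)] u(4) by simp
      ultimately show ?thesis
        using u(3) by (intro bexI[of _ "M_Power ?\<gamma> n"]) (auto simp: center_indices_def)
    qed
  qed
qed

text \<open>Connectedness is reachability in the symmetric closure, whose edges are arrows and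
  reversed arrows; an equality of values holds along both.\<close>

lemma vertices_connected:
  assumes "\<And>a. a \<in> arcs Q \<Longrightarrow> g (head Q a) = g (tail Q a)" "u \<in> verts Q" "v \<in> verts Q"
  shows "g u = g v"
proof -
  have "u \<rightarrow>\<^sup>*\<^bsub>with_proj (mk_symmetric Q)\<^esub> v"
    using quiver assms(2,3) by (simp add: quiver_def Digraph_Component.connected_def strongly_connected_def)
  then have "(u, v) \<in> rtrancl_on (verts Q) (arcs_ends (with_proj (mk_symmetric Q)))"
    by (simp add: reachable_def)
  then show ?thesis
  proof (induction rule: rtrancl_on.induct)
    case (rtrancl_on_into_rtrancl_on a b c)
    then show ?case using assms(1) by (auto simp: arcs_ends_def arc_to_ends_def mk_symmetric_def)
  qed simp
qed

lemma center_constant: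
  assumes X: "X \<in> Z" and i: "i \<in> center_indices Q I" and "p \<in> index_paths i" "q \<in> index_paths i"
  shows "nf X p = nf X q"
proof -
  have XA: "X \<in> carrier A" using X by (rule center_closed)
  have arr: "(if hd w = a then nf X (head Q a, tl w) else 0) = (if last w = a then nf X (u, butlast w) else 0)"
    if "a \<in> arcs Q" "(u, w) \<in> B" "w \<noteq> []" for u w a
    using X that center_iff[OF XA] by blast
  show ?thesis
  proof (cases i)
    case Identity
    \<comment> \<open>At a path consisting of a single arrow, cutting off that arrow from the left
      leaves its head and from the right its tail.\<close>
    have "nf X (head Q a, []) = nf X (tail Q a, [])" if "a \<in> arcs Q" for a
      using arr[of a "tail Q a" "[a]"] that by (simp add: basis_iff)
    then have "nf X (u, []) = nf X (v, [])" if "u \<in> verts Q" "v \<in> verts Q" for u v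
      using vertices_connected[of "\<lambda>v. nf X (v, [])" u v] that by simp
    then show ?thesis using assms(3,4) Identity by auto
  next
    case (Maximal_Cycle r)
    then show ?thesis using assms(3,4) by simp
  next
    case (M_Power \<gamma> n)
    \<comment> \<open>The criterion is applied to the power of \<open>l\<close> followed by the
      first arrow of \<open>l\<close>: without its last arrow this is the power of \<open>l\<close>,
      without its first arrow the same power of the rotated cycle.\<close>
    have step: "nf X (path_power (list_path (rotate1 l)) n) = nf X (path_power (list_path l) n)"
      if l: "cyclic l" and n: "n > 0" for l
    proof -
      let ?w = "concat (replicate n l)"
      note w = cyclic_concat_replicate[OF l n]
      have ne: "?w \<noteq> []" using w(1) by (simp add: cyclic_def)
      obtain x xs where x: "l = x # xs" using l by (cases l) (auto simp: cyclic_def)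
      have "follows (last ?w) x" using l w by (simp add: cyclic_def x)
      then have B: "(tail Q (hd ?w), ?w @ [x]) \<in> B" and xQ: "x \<in> arcs Q"
        using w(1) cyclic_arcs[OF w(1)] ne follows_arcs by (auto simp: basis_iff successively_append_iff cyclic_def)
      have hd: "hd (?w @ [x]) = x" using w(2) ne by (simp add: x)
      have tl: "tl (?w @ [x]) = concat (replicate n (rotate1 l))"
        using concat_replicate_snoc[of n x xs] by (simp add: x)
      have "nf X (head Q x, tl (?w @ [x])) = nf X (tail Q (hd ?w), ?w)"
        using arr[OF xQ B] hd by simp
      moreover have "(head Q x, tl (?w @ [x])) = list_path (tl (?w @ [x]))"
        using basis_list_path[OF tl_basis[OF B]] hd ne by simp
      ultimately have "nf X (list_path (concat (replicate n (rotate1 l)))) = nf X (list_path ?w)"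
        unfolding tl by (simp add: list_path_def)
      then show ?thesis using l n by (simp add: path_power_list_path cyclic_rotate1)
    qed
    have rot: "nf X (path_power (list_path (rotate k l)) n) = nf X (path_power (list_path l) n)"
      if l: "cyclic l" and n: "n > 0" for k l
      by (induction k) (simp_all add: step[OF cyclic_rotate[OF l] n])
    obtain l where l: "p = path_power (list_path l) n" "cyclic l" "n > 0" "\<gamma> = rotations Q (list_path l)"
      using assms(3) i unfolding M_Power by (elim index_paths_M_PowerE)
    obtain k where "q = path_power (list_path (rotate k l)) n"
      using assms(4) l(4) unfolding M_Power by (auto simp: rotations_list_path)
    then show ?thesis using rot[OF l(2,3)] l(1) by simp
  qed
qed

end

section \<open>Expansion, independence and generation\<close>

context gentle_quiver
begin

lemma center_expansion:
  assumes X: "X \<in> Z"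
  shows "\<exists>a U. finite U \<and> U \<subseteq> center_family Q I ` center_indices Q I \<and> X = (\<Oplus>\<^bsub>A\<^esub>v\<in>U. a v \<odot>\<^bsub>A\<^esub> v)"
proof -
  let ?J = "center_indices Q I" and ?F = "center_family Q I"
  have XA: "X \<in> carrier A" using X by (rule center_closed)
  define T where "T = {i \<in> ?J. \<exists>p\<in>index_paths i. nf X p \<noteq> 0}"
  \<comment> \<open>The choice of path is harmless because a central element is constant on
    \<open>index_paths i\<close>.\<close>
  define c where "c i = nf X (SOME p. p \<in> index_paths i)" for i
  \<comment> \<open>A linear combination takes its coefficients as a function of the vectors, so the
    index is recovered from the vector by injectivity of the family.\<close>
  define a where "a v = c (the_inv_into ?J ?F v)" for v
  have TJ: "T \<subseteq> ?J" by (auto simp: T_def)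
  have c: "c i = nf X p" if "i \<in> ?J" "p \<in> index_paths i" for i p
    unfolding c_def using that center_constant[OF X that(1)] by (metis someI_ex)
  have a: "a (?F i) = c i" if "i \<in> ?J" for i
    using that by (simp add: a_def the_inv_into_f_f[OF inj_on_center_family])
  \<comment> \<open>By disjointness a path belongs to at most one index, so the relevant indices are
    the image of the finite support of \<open>X\<close>.\<close>
  have "T \<subseteq> (\<lambda>p. THE i. i \<in> ?J \<and> p \<in> index_paths i) ` {p \<in> B. nf X p \<noteq> 0}"
  proof
    fix i
    assume i: "i \<in> T"
    then obtain p where p: "p \<in> index_paths i" "nf X p \<noteq> 0" by (auto simp: T_def)
    have iJ: "i \<in> ?J" using i TJ by blast
    have "(THE i. i \<in> ?J \<and> p \<in> index_paths i) = i"
      using iJ p index_paths_disjoint by (intro the_equality) blast+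
    moreover have "p \<in> B" using index_paths_props(3)[OF iJ] p by blast
    ultimately show "i \<in> (\<lambda>p. THE i. i \<in> ?J \<and> p \<in> index_paths i) ` {p \<in> B. nf X p \<noteq> 0}"
      using p(2) by (intro image_eqI[of _ _ p]) simp_all
  qed
  then have finT: "finite T" using finite_nf_support[OF XA] by (rule finite_surj[rotated])
  have closed: "(\<lambda>v. a v \<odot>\<^bsub>A\<^esub> v) \<in> ?F ` T \<rightarrow> carrier A"
    using TJ center_family_closed by (auto intro!: smult_closed)
  have "X = (\<Oplus>\<^bsub>A\<^esub>v\<in>?F ` T. a v \<odot>\<^bsub>A\<^esub> v)"
  proof (rule nf_eqI[OF XA A.finsum_closed[OF closed]])
    fix p
    assume p: "p \<in> B"
    have "nf (\<Oplus>\<^bsub>A\<^esub>v\<in>?F ` T. a v \<odot>\<^bsub>A\<^esub> v) p = (\<Sum>v\<in>?F ` T. nf (a v \<odot>\<^bsub>A\<^esub> v) p)"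
      by (rule nf_finsum[OF closed p])
    also have "\<dots> = (\<Sum>i\<in>T. nf (a (?F i) \<odot>\<^bsub>A\<^esub> ?F i) p)"
      using sum.reindex[OF inj_on_subset[OF inj_on_center_family TJ]] by simp
    also have "\<dots> = (\<Sum>i\<in>T. if p \<in> index_paths i then nf X p else 0)"
    proof (rule sum.cong)
      fix i
      assume "i \<in> T"
      then have i: "i \<in> ?J" using TJ by blast
      show "nf (a (?F i) \<odot>\<^bsub>A\<^esub> ?F i) p = (if p \<in> index_paths i then nf X p else 0)"
        using c[OF i] by (simp add: a[OF i] nf_smult[OF center_family_closed[OF i] p] nf_center_family[OF i p])
    qed simp
    also have "\<dots> = nf X p"
    proof (cases "nf X p = 0")
      case False
      obtain j where j: "j \<in> ?J" "p \<in> index_paths j" using center_support[OF X p False] by blast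
      then have "j \<in> T" using False by (auto simp: T_def)
      have "(\<Sum>i\<in>T. if p \<in> index_paths i then nf X p else 0) = (\<Sum>i\<in>T. if i = j then nf X p else 0)"
      proof (rule sum.cong)
        fix i
        assume "i \<in> T"
        then have "p \<in> index_paths i \<longleftrightarrow> i = j"
          using index_paths_disjoint[of i p j] j TJ by blast
        then show "(if p \<in> index_paths i then nf X p else 0) = (if i = j then nf X p else 0)"
          by simp
      qed simp
      then show ?thesis using finT \<open>j \<in> T\<close> by simp
    qed simp
    finally show "nf X p = nf (\<Oplus>\<^bsub>A\<^esub>v\<in>?F ` T. a v \<odot>\<^bsub>A\<^esub> v) p" ..
  qed
  then show ?thesis using finT TJ by (intro exI[of _ a] exI[of _ "?F ` T"]) blast
qed

lemma submodule_center: "submodule class_ring Z A"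
proof (rule submodule.intro[OF module_A])
  show "Z \<subseteq> carrier A" by (rule subringE(1)[OF center_subring])
  show "\<zero>\<^bsub>A\<^esub> \<in> Z" by (rule subringE(2)[OF center_subring])
  show "v \<oplus>\<^bsub>A\<^esub> w \<in> Z" if "v \<in> Z" "w \<in> Z" for v w
    using that by (rule subringE(7)[OF center_subring])
  show "c \<odot>\<^bsub>A\<^esub> v \<in> Z" if "v \<in> Z" for c v
    using that by (rule center_smult)
qed

text \<open>The coefficient at one path of the index belonging to \<open>v\<close> sees no other
  member of the family.\<close>

lemma center_family_independent:
  assumes "finite U" "U \<subseteq> center_family Q I ` center_indices Q I"
    and zero: "(\<Oplus>\<^bsub>A\<^esub>v\<in>U. a v \<odot>\<^bsub>A\<^esub> v) = \<zero>\<^bsub>A\<^esub>" and "v \<in> U"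
  shows "a v = 0"
proof -
  obtain i where i: "i \<in> center_indices Q I" "v = center_family Q I i" using assms(2,4) by blast
  obtain p where p: "p \<in> index_paths i" "p \<in> B" using index_paths_props(2,3)[OF i(1)] by blast
  have U: "U \<subseteq> carrier A" using assms(2) center_family_closed by blast
  then have closed: "(\<lambda>v. a v \<odot>\<^bsub>A\<^esub> v) \<in> U \<rightarrow> carrier A" by (auto intro!: smult_closed)
  have "0 = (\<Sum>w\<in>U. nf (a w \<odot>\<^bsub>A\<^esub> w) p)"
    using nf_finsum[OF closed p(2)] zero nf_zero[OF p(2)] by simp
  also have "\<dots> = (\<Sum>w\<in>U. if w = v then a v else 0)"
  proof (rule sum.cong)
    fix w
    assume w: "w \<in> U"
    then obtain j where j: "j \<in> center_indices Q I" "w = center_family Q I j" using assms(2) by blast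
    have "p \<in> index_paths j \<longleftrightarrow> w = v"
      using index_paths_disjoint[OF i(1) p(1) j(1)] inj_onD[OF inj_on_center_family _ j(1) i(1)] i j p(1)
      by blast
    then have "nf w p = (if w = v then 1 else 0)"
      using nf_center_family[OF j(1) p(2)] j(2) by simp
    moreover have "nf (a w \<odot>\<^bsub>A\<^esub> w) p = a w * nf w p"
      using w U p(2) by (intro nf_smult) auto
    ultimately show "nf (a w \<odot>\<^bsub>A\<^esub> w) p = (if w = v then a v else 0)" by simp
  qed simp
  also have "\<dots> = a v" using assms(1,4) by simp
  finally show ?thesis by simp
qed

lemma center_family_basis:
  "vectorspace.basis class_ring (A\<lparr>carrier := Z\<rparr>) (center_family Q I ` center_indices Q I)"
proof -
  let ?S = "center_family Q I ` center_indices Q I"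
  have W: "vectorspace class_ring (A\<lparr>carrier := Z\<rparr>)"
    using vectorspace.subspace_is_vs[OF vectorspace_A subspace.intro[OF vectorspace_A submodule_center]] .
  have SZ: "?S \<subseteq> Z" using center_family_central by blast
  \<comment> \<open>Span and independence are computed in \<open>A\<close> and carried over to the
    subspace \<open>Z\<close>.\<close>
  note depend = module.span_li_not_depend[OF module_A SZ submodule_center]
  have "\<not> module.lin_dep class_ring A ?S"
    unfolding module.lin_dep_def[OF module_A] module.lincomb_def[OF module_A]
    using center_family_independent by auto
  moreover have "LinearCombinations.module.span class_ring A ?S = Z"
  proof
    show "LinearCombinations.module.span class_ring A ?S \<subseteq> Z"
      using module.span_is_subset[OF module_A SZ submodule_center] .
    show "Z \<subseteq> LinearCombinations.module.span class_ring A ?S"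
      unfolding LinearCombinations.module.span_def[OF module_A] module.lincomb_def[OF module_A]
      using center_expansion by fastforce
  qed
  ultimately show ?thesis
    unfolding vectorspace.basis_def[OF W] depend using SZ by simp
qed

text \<open>Expansions involve powers of the elements of the infinite maximal paths, and these
  powers lie in every subalgebra containing the elements; so spanning by the family gives
  generation.\<close>

lemma center_generated:
  "Z = generated_subalgebra A ({\<one>\<^bsub>A\<^esub>} \<union> path_class Q I ` finite_maximal_cycles Q I
    \<union> m_element Q I ` infinite_maximal_paths Q I)" (is "_ = generated_subalgebra A ?G")
proof
  have "?G \<subseteq> Z"
    using subringE(3)[OF center_subring] finite_maximal_cycle_central m_element_central by auto
  then show "generated_subalgebra A ?G \<subseteq> Z"
    unfolding generated_subalgebra_def using center_subring center_smult by (intro Inter_lower) blast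
  show "Z \<subseteq> generated_subalgebra A ?G"
    unfolding generated_subalgebra_def
  proof (intro subsetI InterI)
    fix X S
    assume X: "X \<in> Z" and "S \<in> {S. subring S A \<and> (\<forall>c. \<forall>b\<in>S. c \<odot>\<^bsub>A\<^esub> b \<in> S) \<and> ?G \<subseteq> S}"
    then have S: "subring S A" "\<And>c b. b \<in> S \<Longrightarrow> c \<odot>\<^bsub>A\<^esub> b \<in> S" "?G \<subseteq> S" by auto
    obtain a U where U: "finite U" "U \<subseteq> center_family Q I ` center_indices Q I"
      and X': "X = (\<Oplus>\<^bsub>A\<^esub>v\<in>U. a v \<odot>\<^bsub>A\<^esub> v)"
      using center_expansion[OF X] by blast
    have "center_family Q I i \<in> S" if "i \<in> center_indices Q I" for i
      using S that by (intro center_family_in_subring) auto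
    then have "U \<subseteq> S" using U(2) by blast
    with U(1) have "(\<Oplus>\<^bsub>A\<^esub>v\<in>U. a v \<odot>\<^bsub>A\<^esub> v) \<in> S"
    proof (induction U)
      case empty
      then show ?case using subringE(2)[OF S(1)] by simp
    next
      case (insert v U)
      have "(\<lambda>v. a v \<odot>\<^bsub>A\<^esub> v) \<in> insert v U \<rightarrow> carrier A"
        using insert.prems S(2) subringE(1)[OF S(1)] by blast
      then show ?case
        using insert S(2) subringE(7)[OF S(1)] by (subst A.finsum_insert) auto
    qed
    then show "X \<in> S" by (simp add: X')
  qed
qed

end

theorem lemma2p17:
  fixes Q :: "('v, 'e) pre_digraph"
    and I :: "(('v, 'e) quiver_path \<Rightarrow>\<^sub>0 'k::field_char_0) set"
  assumes "gentle Q I \<or> locally_gentle Q I"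
  shows "algebra_center (bound_quiver_algebra Q I) =
      generated_subalgebra (bound_quiver_algebra Q I)
        ({\<one>\<^bsub>bound_quiver_algebra Q I\<^esub>}
          \<union> path_class Q I ` finite_maximal_cycles Q I
          \<union> m_element Q I ` infinite_maximal_paths Q I)
    \<and> inj_on (center_family Q I) (center_indices Q I)
    \<and> vectorspace.basis class_ring
        ((bound_quiver_algebra Q I)\<lparr>carrier := algebra_center (bound_quiver_algebra Q I)\<rparr>)
        (center_family Q I ` center_indices Q I)"
proof -
  interpret gentle_quiver Q I
    using assms by unfold_locales (auto simp: gentle_def locally_gentle_def)
  show ?thesis
    using center_generated inj_on_center_family center_family_basis by blast
qed

end
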